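(* Assume in addition that the unwrapping satisfies $\bar f_t=\mathrm{id}$ on the annulus $S\times[0,3/4]\subset D$ for every $t\in J$. Then for each $t\in J$, the measure $\mu_t$, regarded as a measure on $D$ supported on $I$, is physical for $H_t$ with respect to the coordinate measure $dy\,ds$ on $D$; consequently the measure $\hat\mu_t$ on $\hat D_t$ is an inverse limit physical measure for $\hat H_t$, i.e. it has a basin $\hat B\subset\hat D_t$ with $\pi_0(\hat B)$ of positive $dy\,ds$-measure.
   Context: Let $I=[-1,1]$, $J=(1,2]$, $f_t(x)=\min(t(x-1)+3,\,t(1-x)-1)$, $\mu_t$ the unique absolutely continuous $f_t$-invariant probability on $I$. Let $S$ be the circle of radius 2 with angular coordinate $y$ and $D$ the disk of radius 2 with coordinates $(y,s)\in S\times[0,1]$ (from a smooth embedding of the mapping cylinder of $y\mapsto\cos y$), where $(y,0)=y\in S$ and $(y,1)=\cos y\in I\subset D$. Let $\Upsilon(y,s)=(y,2s)$ for $s\le1/2$, $(y,1)$ for $s\ge1/2$. An unwrapping is a continuous family of orientation-preserving near-homeomorphisms $\bar f_t\colon D\to D$ with $\bar f_t$ injective on $I$, $\bar f_t(I)\subset\{s\ge 1/2\}$, $\Upsilon\circ\bar f_t|_I=f_t$, and second coordinate of $\bar f_t(y,s)$ equal to $s$ for $s\le1/2$. $H_t=\Upsilon\circ\bar f_t$, $\hat D_t=\varprojlim(D,H_t)$ (threads $\langle z_0,z_1,\dots\rangle$ with $H_t(z_{n+1})=z_n$, projections $\pi_n$, natural extension $\hat H_t$), and $\hat\mu_t$ the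 unique $\hat H_t$-invariant measure with $(\pi_n)_*\hat\mu_t=\mu_t$. For continuous $f\colon M\to M$ with invariant probability $\nu$, a point $x$ is regular for $\nu$ if $\frac1n\sum_{i<n}\alpha(f^ix)\to\int\alpha\,d\nu$ for all continuous $\alpha$; a basin is a set of regular points; $\nu$ is physical if it has a basin of positive Lebesgue measure. *)

theory Defs
  imports "HOL-Analysis.Analysis" "HOL-Complex_Analysis.Complex_Analysis"
begin

definition Jint :: "real set" where "Jint = {1<..2}"

definition ftent :: "real \<Rightarrow> real \<Rightarrow> real" where
  "ftent t x = min (t * (x - 1) + 3) (t * (1 - x) - 1)"

text \<open>Concrete smooth embedding of the mapping cylinder of y -> cos y into the complex plane:
  (y,s) is sent to ((2-s) cos y, 2(1-s) sin y).  (y,0) lies on the circle S of radius 2 at angle y,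
  and (y,1) is the real point cos y of I.\<close>
definition cc :: "real \<Rightarrow> real \<Rightarrow> complex" where
  "cc y s = Complex ((2 - s) * cos y) (2 * (1 - s) * sin y)"

definition Dsk :: "complex set" where
  "Dsk = (\<lambda>(y, s). cc y s) ` (UNIV \<times> {0..1})"

definition Iset :: "complex set" where
  "Iset = complex_of_real ` {-1..1}"

definition Sband :: "real \<Rightarrow> real \<Rightarrow> complex set" where
  "Sband a b = {cc y s | y s. a \<le> s \<and> s \<le> b \<and> 0 \<le> s \<and> s \<le> 1}"

definition Ups :: "complex \<Rightarrow> complex" where
  "Ups z = (SOME w. \<exists>y s. 0 \<le> s \<and> s \<le> 1 \<and> z = cc y s \<and> w = cc y (min 1 (2 * s)))"

definition op_homeo :: "(complex \<Rightarrow> complex) \<Rightarrow> bool" where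
  "op_homeo h \<longleftrightarrow> (\<exists>g. homeomorphism Dsk Dsk h g)
      \<and> winding_number (h \<circ> circlepath 0 2) (h 0) = 1"

definition op_near_homeo :: "(complex \<Rightarrow> complex) \<Rightarrow> bool" where
  "op_near_homeo f \<longleftrightarrow> f ` Dsk \<subseteq> Dsk \<and>
     (\<forall>e>0. \<exists>h. op_homeo h \<and> (\<forall>z\<in>Dsk. dist (f z) (h z) < e))"

definition unwrapping :: "(real \<Rightarrow> complex \<Rightarrow> complex) \<Rightarrow> bool" where
  "unwrapping fb \<longleftrightarrow>
     continuous_on (Jint \<times> Dsk) (\<lambda>(t, z). fb t z) \<and>
     (\<forall>t\<in>Jint.
        op_near_homeo (fb t) \<and>
        inj_on (fb t) Iset \<and>
        fb t ` Iset \<subseteq> Sband (1/2) 1 \<and>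
        (\<forall>x\<in>{-1..1}. Ups (fb t (complex_of_real x)) = complex_of_real (ftent t x)) \<and>
        (\<forall>y s. 0 \<le> s \<and> s \<le> 1/2 \<longrightarrow> (\<exists>y'. fb t (cc y s) = cc y' s)))"

definition Hmap :: "(real \<Rightarrow> complex \<Rightarrow> complex) \<Rightarrow> real \<Rightarrow> complex \<Rightarrow> complex" where
  "Hmap fb t = Ups \<circ> fb t"

definition acim :: "real \<Rightarrow> real measure \<Rightarrow> bool" where
  "acim t \<mu> \<longleftrightarrow> sets \<mu> = sets borel \<and> emeasure \<mu> UNIV = 1 \<and> emeasure \<mu> {-1..1} = 1 \<and>
     absolutely_continuous lborel \<mu> \<and> distr \<mu> borel (ftent t) = \<mu>"

definition nuD :: "real measure \<Rightarrow> complex measure" where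
  "nuD \<mu> = distr \<mu> borel complex_of_real"

definition Dhat :: "(complex \<Rightarrow> complex) \<Rightarrow> (nat \<Rightarrow> complex) set" where
  "Dhat H = {z. (\<forall>n. z n \<in> Dsk) \<and> (\<forall>n. H (z (Suc n)) = z n)}"

definition Hhat :: "(complex \<Rightarrow> complex) \<Rightarrow> (nat \<Rightarrow> complex) \<Rightarrow> (nat \<Rightarrow> complex)" where
  "Hhat H z = (\<lambda>n. case n of 0 \<Rightarrow> H (z 0) | Suc m \<Rightarrow> z m)"

definition invlim_measure ::
  "(complex \<Rightarrow> complex) \<Rightarrow> complex measure \<Rightarrow> (nat \<Rightarrow> complex) measure \<Rightarrow> bool" where
  "invlim_measure H \<nu> \<mu>h \<longleftrightarrow> sets \<mu>h = sets borel \<and> emeasure \<mu>h (Dhat H) = 1 \<and>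
     distr \<mu>h borel (Hhat H) = \<mu>h \<and> (\<forall>n. distr \<mu>h borel (\<lambda>z. z n) = \<nu>)"

definition regular_pt ::
  "'a::topological_space set \<Rightarrow> ('a \<Rightarrow> 'a) \<Rightarrow> 'a measure \<Rightarrow> 'a \<Rightarrow> bool" where
  "regular_pt M f \<nu> x \<longleftrightarrow> x \<in> M \<and>
     (\<forall>\<alpha>::'a \<Rightarrow> real. continuous_on M \<alpha> \<longrightarrow>
        (\<lambda>n. (\<Sum>i<n. \<alpha> ((f ^^ i) x)) / real n) \<longlonglongrightarrow> integral\<^sup>L (restrict_space \<nu> M) \<alpha>)"

definition basin :: "'a::topological_space set \<Rightarrow> ('a \<Rightarrow> 'a) \<Rightarrow> 'a measure \<Rightarrow> 'a set \<Rightarrow> bool" where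
  "basin M f \<nu> B \<longleftrightarrow> B \<subseteq> M \<and> (\<forall>x\<in>B. regular_pt M f \<nu> x)"

definition coord_pos :: "complex set \<Rightarrow> bool" where
  "coord_pos B \<longleftrightarrow>
     (let P = {p \<in> {0..2*pi} \<times> {0..1}. cc (fst p) (snd p) \<in> B}
      in P \<in> sets lebesgue \<and> emeasure lebesgue P > 0)"

definition physical :: "(complex \<Rightarrow> complex) \<Rightarrow> complex measure \<Rightarrow> bool" where
  "physical H \<nu> \<longleftrightarrow> (\<exists>B. basin Dsk H \<nu> B \<and> coord_pos B)"

definition invlim_physical ::
  "(complex \<Rightarrow> complex) \<Rightarrow> (nat \<Rightarrow> complex) measure \<Rightarrow> bool" where
  "invlim_physical H \<mu>h \<longleftrightarrow>
     (\<exists>B. basin (Dhat H) (Hhat H) \<mu>h B \<and> coord_pos ((\<lambda>z. z 0) ` B))"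

end

theory Submission
  imports Defs
begin

text \<open>On the annulus where the unwrapping is the identity, a point (y,s) with s in [1/2,3/4] is sent
  by H to cos y in I, where H acts as the tent map. So it suffices that almost every point of a set of
  positive length in I is regular for \<mu>: the set of y with cos y in it then has positive length too,
  and each (y,s) starts the thread (y,s/2), (y,s/4), ... of the inverse limit.

  Regularity follows from Birkhoff's theorem once Lebesgue measure has no nontrivial invariant sets.
  If A is invariant and meets I in positive length, then A contains an interval up to a null set:
  otherwise compactness gives \<eta> > 0 with \<lambda>(W - A) \<ge> \<eta> \<lambda>(W) for all W of length at least \<epsilon>, and
  pulling this bound back along f^N with t^N > 2, where short intervals are cut at most once,
  extends it to all intervals, which forces A to be null. The full interval expands
  until it contains the turning point in its interior. The same holds for the complement of A, and two
  disjoint sets cannot both be full near the turning point.\<close>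

section \<open>Invariant sets of expanding tent maps\<close>

locale expanding_tent =
  fixes t :: real
  assumes t_gt_1: "1 < t" and t_le_2: "t \<le> 2"
begin

text \<open>The turning point: the two affine branches in \<open>ftent\<close> meet there.\<close>

definition c :: real where "c = 1 - 2 / t"

lemma c_bounds: "-1 < c" "c < 1"
  using t_gt_1 by (auto simp: c_def field_simps)

lemma ftent_left: "x \<le> c \<Longrightarrow> ftent t x = t * x + (3 - t)"
  using t_gt_1 by (auto simp: ftent_def c_def field_simps min_def)

lemma ftent_right: "c \<le> x \<Longrightarrow> ftent t x = - t * x + (t - 1)"
  using t_gt_1 by (auto simp: ftent_def c_def field_simps min_def)

lemma ftent_c: "ftent t c = 1"
  using t_gt_1 by (simp add: ftent_left) (simp add: c_def field_simps)

text \<open>Since \<open>t * c = t - 2\<close>, both branches reach the value 1 at \<open>c\<close>.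
  The endpoint 1 goes to -1 and the endpoint -1 goes to \<open>3 - 2 * t\<close>, which is at least
  -1 because t \<le> 2.\<close>

lemma ftent_in_I:
  assumes "x \<in> {-1..1}" shows "ftent t x \<in> {-1..1}"
proof (cases "x \<le> c")
  case True
  have "t * (-1) \<le> t * x" "t * x \<le> t * c"
    using assms True t_gt_1 by (intro mult_left_mono; simp)+
  moreover have "t * c = t - 2" using t_gt_1 by (simp add: c_def field_simps)
  ultimately show ?thesis using True t_le_2 by (simp add: ftent_left)
next
  case False
  have "t * x \<le> t * 1" "t * c \<le> t * x"
    using assms False t_gt_1 by (intro mult_left_mono; simp)+
  moreover have "t * c = t - 2" using t_gt_1 by (simp add: c_def field_simps)
  ultimately show ?thesis using False t_le_2 by (simp add: ftent_right)
qed

lemma continuous_on_ftent: "continuous_on S (ftent t)"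
  unfolding ftent_def by (intro continuous_intros)

end

section \<open>Transport of the complement of an invariant set along the tent map\<close>

locale tent_invariant_set = expanding_tent +
  fixes A :: "real set"
  assumes A_borel [measurable]: "A \<in> sets borel"
    and A_invariant: "x \<in> {-1..1} \<Longrightarrow> ftent t x \<in> A \<longleftrightarrow> x \<in> A"
begin

text \<open>Gap zero means that \<open>A\<close> fills the interval up to a null set; a lower bound
  proportional to length, valid on all intervals of I, forces \<open>A\<close> to be null
  there.\<close>

definition gap :: "real \<Rightarrow> real \<Rightarrow> real" where
  "gap a b = measure lebesgue ({a..b} - A)"

lemma gap_sets: "{a..b} - A \<in> lmeasurable"
  by (intro fmeasurable_Diff) auto

lemma gap_nonneg: "0 \<le> gap a b"
  by (simp add: gap_def)

lemma gap_le: "a \<le> b \<Longrightarrow> gap a b \<le> b - a"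
proof -
  assume "a \<le> b"
  have "gap a b \<le> measure lebesgue {a..b}"
    unfolding gap_def by (rule measure_mono_fmeasurable) (use A_borel in auto)
  then show ?thesis using \<open>a \<le> b\<close> by simp
qed

lemma gap_split:
  assumes "a \<le> b" "b \<le> d" shows "gap a d = gap a b + gap b d"
proof -
  have "{a..d} - A = ({a..b} - A) \<union> ({b..d} - A)" using assms by auto
  moreover have "negligible (({a..b} - A) \<inter> ({b..d} - A))"
    by (rule negligible_subset[of "{b}"]) auto
  ultimately show ?thesis
    by (simp only: gap_def measure_Un3[OF gap_sets gap_sets] negligible_imp_measure0 diff_0_right)
qed

text \<open>Two-sided invariance makes the map carry the part of the interval outside
  \<open>A\<close> exactly onto the part of the image outside \<open>A\<close>, so an affine branch
  scales gaps by the same factor as lengths.\<close>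

lemma gap_affine:
  assumes "-1 \<le> a" "b \<le> 1" "\<And>x. x \<in> {a..b} \<Longrightarrow> ftent t x = m * x + k" "ftent t ` {a..b} = {a'..b'}"
  shows "gap a' b' = \<bar>m\<bar> * gap a b"
proof -
  have "{a'..b'} - A = ftent t ` ({a..b} - A)"
    using assms(1,2,4) A_invariant by (auto simp flip: assms(4))
  also have "\<dots> = (\<lambda>x. m *\<^sub>R x + k) ` ({a..b} - A)"
    using assms(3) by (auto intro!: image_cong)
  finally show ?thesis
    by (simp only: gap_def measure_lebesgue_affine[of m k] DIM_real power_one_right)
qed

lemma gap_ftent_left:
  assumes "-1 \<le> a" "a \<le> b" "b \<le> c"
  shows "gap (ftent t a) (ftent t b) = t * gap a b" "ftent t b - ftent t a = t * (b - a)"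
proof -
  have "ftent t ` {a..b} = (\<lambda>x. t * x + (3 - t)) ` {a..b}"
    using assms by (auto intro!: image_cong simp: ftent_left)
  also have "\<dots> = {ftent t a..ftent t b}"
    using assms t_gt_1 by (subst image_affinity_atLeastAtMost) (auto simp: ftent_left)
  finally show "gap (ftent t a) (ftent t b) = t * gap a b"
    using assms c_bounds t_gt_1 gap_affine[of a b t "3 - t"] by (auto simp: ftent_left)
  show "ftent t b - ftent t a = t * (b - a)"
    using assms by (simp add: ftent_left algebra_simps)
qed

lemma gap_ftent_right:
  assumes "b \<le> 1" "a \<le> b" "c \<le> a"
  shows "gap (ftent t b) (ftent t a) = t * gap a b" "ftent t a - ftent t b = t * (b - a)"
proof -
  have "ftent t ` {a..b} = (\<lambda>x. (-t) * x + (t - 1)) ` {a..b}"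
    using assms by (auto intro!: image_cong simp: ftent_right)
  also have "\<dots> = {ftent t b..ftent t a}"
    using assms t_gt_1 by (subst image_affinity_atLeastAtMost) (auto simp: ftent_right)
  finally show "gap (ftent t b) (ftent t a) = t * gap a b"
    using assms c_bounds t_gt_1 gap_affine[of a b "-t" "t - 1"] by (auto simp: ftent_right)
  show "ftent t a - ftent t b = t * (b - a)"
    using assms by (simp add: ftent_right algebra_simps)
qed

text \<open>Without \<open>c\<close> in its interior the interval lies in a single branch. The right
  branch reverses orientation, so the new endpoints are recorded only as an unordered pair.\<close>

lemma gap_ftent_uncut:
  assumes "-1 \<le> a" "a \<le> b" "b \<le> 1" "c \<notin> {a<..<b}"
  obtains a' b' where "-1 \<le> a'" "a' \<le> b'" "b' \<le> 1" "b' - a' = t * (b - a)"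
    "gap a' b' = t * gap a b" "{a', b'} = {ftent t a, ftent t b}"
proof (cases "b \<le> c")
  case True
  have "0 \<le> t * (b - a)" using assms t_gt_1 by simp
  then show ?thesis
    using that[of "ftent t a" "ftent t b"] gap_ftent_left[of a b] assms True
      ftent_in_I[of a] ftent_in_I[of b] by force
next
  case False
  have "0 \<le> t * (b - a)" using assms t_gt_1 by simp
  moreover have "c \<le> a" using assms False by auto
  ultimately show ?thesis
    using that[of "ftent t b" "ftent t a"] gap_ftent_right[of b a] assms
      ftent_in_I[of a] ftent_in_I[of b] by force
qed

text \<open>At every stage the interval has length at most \<open>d\<close> and one endpoint on the
  orbit of \<open>e\<close>. That endpoint equals \<open>c\<close> or is at least \<open>d\<close>
  away from it, so \<open>c\<close> is never in the interior and no cut occurs.\<close>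

lemma gap_funpow_endpoint:
  assumes "-1 \<le> a" "a \<le> b" "b \<le> 1" "e \<in> {a, b}"
    and "\<forall>i<j. (ftent t ^^ i) e = c \<or> d \<le> \<bar>(ftent t ^^ i) e - c\<bar>"
    and "t ^ j * (b - a) \<le> d"
  shows "\<exists>a' b'. -1 \<le> a' \<and> a' \<le> b' \<and> b' \<le> 1 \<and> b' - a' = t ^ j * (b - a) \<and> gap a' b' = t ^ j * gap a b"
  using assms
proof (induction j arbitrary: a b e)
  case 0
  then show ?case by auto
next
  case (Suc j)
  have "1 * (b - a) \<le> t ^ Suc j * (b - a)"
    using Suc.prems t_gt_1 by (intro mult_right_mono one_le_power) auto
  with Suc.prems(6) have "b - a \<le> d" by simp
  moreover have "e = c \<or> d \<le> \<bar>e - c\<bar>" using Suc.prems(5) by force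
  ultimately have "c \<notin> {a<..<b}" using Suc.prems(2,4) by auto
  then obtain a' b' where ab: "-1 \<le> a'" "a' \<le> b'" "b' \<le> 1" "b' - a' = t * (b - a)"
    "gap a' b' = t * gap a b" "{a', b'} = {ftent t a, ftent t b}"
    using gap_ftent_uncut Suc.prems by metis
  have "\<exists>a'' b''. -1 \<le> a'' \<and> a'' \<le> b'' \<and> b'' \<le> 1 \<and> b'' - a'' = t ^ j * (b' - a')
      \<and> gap a'' b'' = t ^ j * gap a' b'"
  proof (rule Suc.IH[of a' b' "ftent t e"])
    show "ftent t e \<in> {a', b'}" using ab(6) Suc.prems(4) by auto
    show "\<forall>i<j. (ftent t ^^ i) (ftent t e) = c \<or> d \<le> \<bar>(ftent t ^^ i) (ftent t e) - c\<bar>"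
      using Suc.prems(5) by (metis Suc_less_eq comp_apply funpow_Suc_right)
    show "t ^ j * (b' - a') \<le> d" using Suc.prems(6) ab(4) by (simp add: mult_ac)
  qed (use ab in auto)
  then show ?case using ab by (auto simp: mult_ac)
qed

text \<open>A short interval is cut at most once at the turning point: afterwards both pieces end
  on the forward orbit of the turning value 1, which either hits c or stays away from it.\<close>

lemma gap_funpow:
  assumes "-1 \<le> a" "a \<le> b" "b \<le> 1"
    and "\<forall>i<j. (ftent t ^^ i) 1 = c \<or> d \<le> \<bar>(ftent t ^^ i) 1 - c\<bar>"
    and "t ^ j * (b - a) \<le> d"
  shows "\<exists>a1 b1 a2 b2. -1 \<le> a1 \<and> a1 \<le> b1 \<and> b1 \<le> 1 \<and> -1 \<le> a2 \<and> a2 \<le> b2 \<and> b2 \<le> 1 \<and>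
    (b1 - a1) + (b2 - a2) = t ^ j * (b - a) \<and> gap a1 b1 + gap a2 b2 = t ^ j * gap a b"
  using assms
proof (induction j arbitrary: a b)
  case 0
  \<comment> \<open>The conclusion always speaks of two pieces; an uncut interval is padded with the
    degenerate interval at 1.\<close>
  have "gap 1 1 = 0" using gap_le[of 1 1] gap_nonneg[of 1 1] by simp
  then have "-1 \<le> a \<and> a \<le> b \<and> b \<le> 1 \<and> -1 \<le> (1::real) \<and> (1::real) \<le> 1 \<and> (1::real) \<le> 1 \<and>
    (b - a) + (1 - 1) = t ^ 0 * (b - a) \<and> gap a b + gap 1 1 = t ^ 0 * gap a b" using 0 by simp
  then show ?case by blast
next
  case (Suc j)
  show ?case
  proof (cases "c \<in> {a<..<b}")
    case False
    then obtain a' b' where ab: "-1 \<le> a'" "a' \<le> b'" "b' \<le> 1" "b' - a' = t * (b - a)"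
      "gap a' b' = t * gap a b"
      using gap_ftent_uncut Suc.prems by metis
    show ?thesis
      using Suc.IH[of a' b'] ab Suc.prems by (simp add: mult_ac)
  next
    case True
    \<comment> \<open>One step after the cut both halves have the endpoint 1, so the hypothesis on
      the orbit of 1 excludes further cuts during the remaining \<open>j\<close> steps.\<close>
    have L: "gap (ftent t a) 1 = t * gap a c" "1 - ftent t a = t * (c - a)"
      using gap_ftent_left[of a c] Suc.prems True by (auto simp: ftent_c)
    have R: "gap (ftent t b) 1 = t * gap c b" "1 - ftent t b = t * (b - c)"
      using gap_ftent_right[of b c] Suc.prems True by (auto simp: ftent_c)
    have fa: "-1 \<le> ftent t a" "ftent t a \<le> 1" and fb: "-1 \<le> ftent t b" "ftent t b \<le> 1"
      using ftent_in_I[of a] ftent_in_I[of b] Suc.prems by auto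
    have tj: "t ^ Suc j * (b - a) = t ^ j * (1 - ftent t a) + t ^ j * (1 - ftent t b)"
      unfolding L R by (simp add: algebra_simps)
    have nn: "0 \<le> t ^ j * (1 - ftent t a)" "0 \<le> t ^ j * (1 - ftent t b)"
      using fa fb t_gt_1 by auto
    obtain a1 b1 where 1: "-1 \<le> a1" "a1 \<le> b1" "b1 \<le> 1" "b1 - a1 = t ^ j * (1 - ftent t a)"
      "gap a1 b1 = t ^ j * gap (ftent t a) 1"
      using gap_funpow_endpoint[of "ftent t a" 1 1 j d] fa Suc.prems tj nn by auto
    obtain a2 b2 where 2: "-1 \<le> a2" "a2 \<le> b2" "b2 \<le> 1" "b2 - a2 = t ^ j * (1 - ftent t b)"
      "gap a2 b2 = t ^ j * gap (ftent t b) 1"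
      using gap_funpow_endpoint[of "ftent t b" 1 1 j d] fb Suc.prems tj nn by auto
    have "gap a1 b1 + gap a2 b2 = t ^ Suc j * gap a b"
      using 1 2 L R gap_split[of a c b] True by (simp add: algebra_simps)
    moreover have "(b1 - a1) + (b2 - a2) = t ^ Suc j * (b - a)"
      using 1 2 tj by simp
    ultimately show ?thesis using 1 2 by blast
  qed
qed

text \<open>The additive error b in a bound gap \<ge> \<eta> (length) - b contracts by 2 / t ^ N
  each time the bound is transported by N iterations.\<close>

lemma gap_lower_bound:
  assumes N: "2 < t ^ N"
    and d: "\<forall>i<N. (ftent t ^^ i) 1 = c \<or> d \<le> \<bar>(ftent t ^^ i) 1 - c\<bar>"
    and eps: "t ^ N * eps \<le> d"
    and "0 \<le> eta"
    and long: "\<And>a b. -1 \<le> a \<Longrightarrow> b \<le> 1 \<Longrightarrow> eps \<le> b - a \<Longrightarrow> a \<le> b \<Longrightarrow> eta * (b - a) \<le> gap a b"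
    and "-1 \<le> a" "a \<le> b" "b \<le> 1"
  shows "eta * (b - a) \<le> gap a b"
proof -
  have approx: "eta * (b - a) - 2 * eta * (2 / t ^ N) ^ k \<le> gap a b"
    if "-1 \<le> a" "a \<le> b" "b \<le> 1" for k a b
    using that
  proof (induction k arbitrary: a b)
    case 0
    \<comment> \<open>The initial error \<open>2 * eta\<close> makes the bound trivial, as intervals
      in I have length at most 2.\<close>
    have "eta * (b - a) \<le> eta * 2"
      using 0 \<open>0 \<le> eta\<close> by (intro mult_left_mono) auto
    then show ?case using gap_nonneg[of a b] by simp
  next
    case (Suc k)
    show ?case
    proof (cases "eps \<le> b - a")
      case True
      have "0 \<le> 2 * eta * (2 / t ^ N) ^ Suc k"
        using \<open>0 \<le> eta\<close> t_gt_1 by (intro mult_nonneg_nonneg zero_le_power) auto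
      then show ?thesis using long[of a b] True Suc.prems by auto
    next
      case False
      have "t ^ N * (b - a) \<le> t ^ N * eps"
        using False t_gt_1 by (intro mult_left_mono) auto
      then have "t ^ N * (b - a) \<le> d" using eps by simp
      from gap_funpow[OF Suc.prems d this] obtain a1 b1 a2 b2 where ab: "-1 \<le> a1" "a1 \<le> b1" "b1 \<le> 1" "-1 \<le> a2" "a2 \<le> b2" "b2 \<le> 1"
        "(b1 - a1) + (b2 - a2) = t ^ N * (b - a)" "gap a1 b1 + gap a2 b2 = t ^ N * gap a b"
        by blast
      have "eta * (b1 - a1) - 2 * eta * (2 / t ^ N) ^ k + (eta * (b2 - a2) - 2 * eta * (2 / t ^ N) ^ k)
          \<le> t ^ N * gap a b"
        using Suc.IH[of a1 b1] Suc.IH[of a2 b2] ab by linarith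
      also have "eta * (b1 - a1) - 2 * eta * (2 / t ^ N) ^ k + (eta * (b2 - a2) - 2 * eta * (2 / t ^ N) ^ k)
          = eta * ((b1 - a1) + (b2 - a2)) - 4 * eta * (2 / t ^ N) ^ k"
        by (simp add: algebra_simps)
      \<comment> \<open>The 2 from adding the errors of two pieces is written as
        \<open>t ^ N * (2 / t ^ N)\<close>, so that cancelling \<open>t ^ N\<close> leaves the error
        of stage \<open>Suc k\<close>.\<close>
      also have "\<dots> = t ^ N * (eta * (b - a)) - (t ^ N * (2 / t ^ N)) * (2 * eta * (2 / t ^ N) ^ k)"
        using t_gt_1 unfolding ab(7) by simp
      also have "\<dots> = t ^ N * (eta * (b - a) - 2 * eta * (2 / t ^ N) ^ Suc k)"
        unfolding power_Suc right_diff_distrib by (simp only: mult_ac)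
      finally show ?thesis using t_gt_1 by simp
    qed
  qed
  have "\<bar>2 / t ^ N\<bar> < 1" using N t_gt_1 by simp
  then have lim: "(\<lambda>k. (2 / t ^ N) ^ k) \<longlonglongrightarrow> 0"
    by (intro LIMSEQ_power_zero) simp
  have "(\<lambda>k. eta * (b - a) - 2 * eta * (2 / t ^ N) ^ k) \<longlonglongrightarrow> eta * (b - a) - 2 * eta * 0"
    by (rule tendsto_diff[OF tendsto_const tendsto_mult[OF tendsto_const lim]])
  then have "eta * (b - a) - 2 * eta * 0 \<le> gap a b"
    by (rule LIMSEQ_le_const2) (use approx assms in auto)
  then show ?thesis by simp
qed

text \<open>Cover \<open>A \<inter> {-1..1}\<close> by countably many nonoverlapping intervals whose
  union exceeds it in measure by at most \<open>e\<close>. \<open>A\<close> misses at least the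
  proportion \<open>eta\<close> of each interval, while everything missed lies in that excess; so
  \<open>eta\<close> times the measure of the set is at most \<open>e\<close>.\<close>

lemma negligible_if_uniform_gap:
  assumes "0 < eta"
    and gap: "\<And>a b. -1 \<le> a \<Longrightarrow> a \<le> b \<Longrightarrow> b \<le> 1 \<Longrightarrow> eta * (b - a) \<le> gap a b"
  shows "emeasure lborel (A \<inter> {-1..1}) = 0"
proof -
  let ?S = "A \<inter> {-1..1}"
  have S: "?S \<in> lmeasurable"
    by (intro fmeasurable_Int_fmeasurable[of "{-1..1}", simplified Int_commute]) auto
  have "eta * measure lebesgue ?S \<le> e" if e: "0 < e" for e
  proof -
    have "?S \<subseteq> cbox (-1) 1" by auto
    then obtain D where D: "countable D"
      "\<And>K. K \<in> D \<Longrightarrow> K \<subseteq> cbox (-1) 1 \<and> K \<noteq> {} \<and> (\<exists>c d. K = cbox c d)"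
      "pairwise (\<lambda>A B. interior A \<inter> interior B = {}) D"
      "?S \<subseteq> \<Union>D" "\<Union>D \<in> lmeasurable" "measure lebesgue (\<Union>D) \<le> measure lebesgue ?S + e"
      by (rule measurable_outer_intervals_bounded[OF S _ e]) (rule that; blast)
    have box: "\<exists>a b. -1 \<le> a \<and> a \<le> b \<and> b \<le> 1 \<and> K = {a..b}" if "K \<in> D" for K
      using D(2)[OF that] by (auto simp: cbox_interval)
    \<comment> \<open>Only the interiors are disjoint, as countable additivity demands; the
      discarded endpoints form a countable, hence null, set.\<close>
    let ?U = "\<Union>K\<in>D. interior K"
    have Ksets: "K - A \<in> sets lebesgue" "interior K - A \<in> sets lebesgue" if "K \<in> D" for K
      using box[OF that] A_borel by auto
    have disj: "disjoint_family_on interior D"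
      using D(3) by (auto simp: disjoint_family_on_def pairwise_def)
    have "emeasure lebesgue (\<Union>D - ?U) = 0"
    proof -
      have "negligible (\<Union>K\<in>D. K - interior K)"
      proof (rule negligible_countable_Union[of "(\<lambda>K. K - interior K) ` D"])
        fix X assume "X \<in> (\<lambda>K. K - interior K) ` D"
        then obtain K a b where "K \<in> D" "K = {a..b}" "X = K - interior K" using box by blast
        then have "X \<subseteq> {a, b}" by auto
        then show "negligible X" by (rule negligible_subset[rotated]) simp
      qed (use D(1) in auto)
      then have "negligible (\<Union>D - ?U)" by (rule negligible_subset) auto
      then show ?thesis using negligible_iff_emeasure0 negligible_imp_sets by blast
    qed
    note null = this
    have "open ?U" by auto
    then have U: "?U \<in> sets lebesgue"
      by (metis borel_open sets_completionI_sets sets_lborel)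
    have "emeasure lebesgue ?S \<le> emeasure lebesgue (?U \<union> (\<Union>D - ?U))"
      using D(4,5) U by (intro emeasure_mono) auto
    also have "\<dots> \<le> emeasure lebesgue ?U + emeasure lebesgue (\<Union>D - ?U)"
      using D(5) U by (intro emeasure_subadditive) auto
    finally have 1: "emeasure lebesgue ?S \<le> emeasure lebesgue ?U" using null by simp
    have "eta * emeasure lebesgue ?U = (\<integral>\<^sup>+K. eta * emeasure lebesgue (interior K) \<partial>count_space D)"
      using disj D(1) by (subst emeasure_UN_countable) (auto simp: nn_integral_cmult intro!: borel_open)
    also have "\<dots> \<le> (\<integral>\<^sup>+K. emeasure lebesgue (interior K - A) \<partial>count_space D)"
    proof (rule nn_integral_mono)
      fix K assume "K \<in> space (count_space D)"
      then have "K \<in> D" by simp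
      then obtain a b where K: "-1 \<le> a" "a \<le> b" "b \<le> 1" "K = {a..b}" using box by blast
      have "gap a b = measure lebesgue (interior K - A)"
        unfolding gap_def K(4)
      proof (rule measure_negligible_symdiff)
        show "interior {a..b} - A \<in> lmeasurable" using A_borel by (intro fmeasurable_Diff) auto
        show "negligible (interior {a..b} - A - ({a..b} - A) \<union> ({a..b} - A - (interior {a..b} - A)))"
          by (rule negligible_subset[of "{a, b}"]) auto
      qed
      moreover have "interior K - A \<in> lmeasurable"
        using A_borel K(4) by (intro fmeasurable_Diff) auto
      ultimately have "emeasure lebesgue (interior K - A) = ennreal (gap a b)"
        by (simp add: emeasure_eq_measure2)
      moreover have "eta * emeasure lebesgue (interior K) = ennreal (eta * (b - a))"
        using K \<open>0 < eta\<close> by (simp add: ennreal_mult)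
      ultimately show "eta * emeasure lebesgue (interior K) \<le> emeasure lebesgue (interior K - A)"
        using gap[of a b] K by (simp add: ennreal_leI)
    qed
    also have "\<dots> = emeasure lebesgue (\<Union>K\<in>D. interior K - A)"
      using disj D(1) Ksets by (subst emeasure_UN_countable) (auto simp: disjoint_family_on_def)
    also have "\<dots> \<le> emeasure lebesgue (\<Union>D - ?S)"
      using D(5) S interior_subset by (intro emeasure_mono) auto
    also have "\<dots> = ennreal (measure lebesgue (\<Union>D - ?S))"
      using D(5) S by (intro emeasure_eq_measure2) (auto intro: fmeasurable_Diff)
    also have "\<dots> \<le> ennreal e"
      using measurable_measure_Diff[OF D(5) fmeasurableD[OF S] D(4)] D(6) by (intro ennreal_leI) simp
    finally have "eta * emeasure lebesgue ?U \<le> ennreal e" .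
    with 1 have "eta * emeasure lebesgue ?S \<le> ennreal e"
      by (meson mult_left_mono order_trans zero_le)
    then have "ennreal (eta * measure lebesgue ?S) \<le> ennreal e"
      using S \<open>0 < eta\<close> by (simp only: emeasure_eq_measure2 ennreal_mult' less_imp_le)
    then show ?thesis using e by (simp only: ennreal_le_iff less_imp_le)
  qed
  then have "eta * measure lebesgue ?S \<le> 0" by (rule field_le_epsilon) simp
  then have "measure lebesgue ?S \<le> 0" using \<open>0 < eta\<close>
    by (simp only: mult_le_0_iff) auto
  then have "measure lebesgue ?S = 0" using measure_nonneg by (rule order_antisym)
  then have "emeasure lebesgue ?S = 0" using S by (simp only: emeasure_eq_measure2 ennreal_0)
  then show ?thesis by simp
qed

section \<open>From positive measure to a full interval around the turning point\<close>

lemma exists_full_interval: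
  assumes "emeasure lborel (A \<inter> {-1..1}) \<noteq> 0"
  shows "\<exists>a b. -1 \<le> a \<and> a < b \<and> b \<le> 1 \<and> gap a b = 0"
proof (rule ccontr)
  assume none: "\<not> ?thesis"
  obtain N where N: "2 < t ^ N" using real_arch_pow t_gt_1 by blast
  \<comment> \<open>\<open>d\<close> is the smallest of 1 and the nonzero distances to
    \<open>c\<close> of the first \<open>N\<close> orbit points of 1. The inserted 1 keeps the
    minimum defined when there are no such distances and bounds \<open>d\<close> by 1.\<close>
  let ?E = "(\<lambda>i. \<bar>(ftent t ^^ i) 1 - c\<bar>) ` {i. i < N \<and> (ftent t ^^ i) 1 \<noteq> c}"
  define d where "d = Min (insert 1 ?E)"
  have "0 < d" unfolding d_def by (subst Min_gr_iff) auto
  have d: "\<forall>i<N. (ftent t ^^ i) 1 = c \<or> d \<le> \<bar>(ftent t ^^ i) 1 - c\<bar>"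
    unfolding d_def by (auto intro!: Min_le)
  have "d \<le> 1" unfolding d_def by (intro Min_le) auto
  define eps where "eps = d / t ^ N"
  have eps: "0 < eps" "eps \<le> 1" "t ^ N * eps \<le> d"
    using \<open>0 < d\<close> \<open>d \<le> 1\<close> N by (auto simp: eps_def field_simps)
  \<comment> \<open>Endpoint pairs of the intervals of length at least \<open>eps\<close>: a compact
    set, on which the gap attains a minimum, positive by \<open>none\<close>.\<close>
  define X where "X = {p::real \<times> real. -1 \<le> fst p \<and> snd p \<le> 1 \<and> eps \<le> snd p - fst p}"
  have "X \<subseteq> {-1..1} \<times> {-1..1}" using eps by (auto simp: X_def)
  moreover have "closed X"
    unfolding X_def by (intro closed_Collect_conj closed_Collect_le continuous_intros)
  ultimately have "compact X"
    by (metis compact_Icc compact_Int_closed compact_Times inf.absorb_iff2)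
  moreover have "(-1, 1) \<in> X" using eps by (auto simp: X_def)
  moreover have "continuous_on X (\<lambda>p. gap (fst p) (snd p))"
  proof -
    \<comment> \<open>The gap over \<open>{a..b}\<close> is a difference of two values of
      \<open>gap (-1)\<close>, which is 1-Lipschitz since an added piece contributes at most its
      length.\<close>
    have lip: "\<bar>gap (-1) x - gap (-1) y\<bar> \<le> \<bar>x - y\<bar>" if "x \<in> {-1..1}" "y \<in> {-1..1}" for x y
    proof (cases "x \<le> y")
      case True
      then show ?thesis
        using gap_split[of "-1" x y] gap_le[of x y] gap_nonneg[of x y] that by auto
    next
      case False
      then show ?thesis
        using gap_split[of "-1" y x] gap_le[of y x] gap_nonneg[of y x] that by auto
    qed
    have "continuous_on {-1..1} (gap (-1))"
      by (rule lipschitz_on_continuous_on[of 1]) (use lip in \<open>auto simp: lipschitz_on_def dist_real_def\<close>)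
    then have "continuous_on X (\<lambda>p. gap (-1) (snd p))" "continuous_on X (\<lambda>p. gap (-1) (fst p))"
      using \<open>X \<subseteq> _\<close> by (auto elim!: continuous_on_compose2 intro!: continuous_intros)
    then have "continuous_on X (\<lambda>p. gap (-1) (snd p) - gap (-1) (fst p))"
      by (rule continuous_on_diff)
    moreover have "gap (-1) (snd p) - gap (-1) (fst p) = gap (fst p) (snd p)" if "p \<in> X" for p
      using gap_split[of "-1" "fst p" "snd p"] that eps by (auto simp: X_def)
    ultimately show ?thesis by (metis (no_types, lifting) continuous_on_cong)
  qed
  ultimately obtain p where p: "p \<in> X" "\<And>q. q \<in> X \<Longrightarrow> gap (fst p) (snd p) \<le> gap (fst q) (snd q)"
    using continuous_attains_inf[of X "\<lambda>p. gap (fst p) (snd p)"] by blast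
  \<comment> \<open>Halving the minimum compensates for lengths up to 2.\<close>
  define eta where "eta = gap (fst p) (snd p) / 2"
  have "0 < eta"
  proof -
    have "gap (fst p) (snd p) \<noteq> 0" using none p(1) eps by (auto simp: X_def)
    then show ?thesis using gap_nonneg[of "fst p" "snd p"] by (simp add: eta_def)
  qed
  have "eta * (b - a) \<le> gap a b" if "-1 \<le> a" "b \<le> 1" "eps \<le> b - a" "a \<le> b" for a b
  proof -
    have "eta * (b - a) \<le> eta * 2"
      using \<open>0 < eta\<close> that by (intro mult_left_mono) auto
    also have "\<dots> \<le> gap a b" using p(2)[of "(a, b)"] that by (auto simp: X_def eta_def)
    finally show ?thesis .
  qed
  then have "emeasure lborel (A \<inter> {-1..1}) = 0"
    using gap_lower_bound[OF N d eps(3)] \<open>0 < eta\<close>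
    by (intro negligible_if_uniform_gap[of eta]) auto
  with assms show False by simp
qed

text \<open>While \<open>c\<close> stays out of the interior, the image of a full interval is a full
  interval \<open>t\<close> times as long. Lengths in I are at most 2, so this cannot go on
  forever.\<close>

lemma full_interval_reaches_c:
  assumes "-1 \<le> a" "a < b" "b \<le> 1" "gap a b = 0"
  shows "\<exists>a b. -1 \<le> a \<and> b \<le> 1 \<and> a < c \<and> c < b \<and> gap a b = 0"
proof (rule ccontr)
  assume none: "\<not> ?thesis"
  have grow: "\<exists>a' b'. -1 \<le> a' \<and> a' \<le> b' \<and> b' \<le> 1 \<and> gap a' b' = 0 \<and> b' - a' = t ^ n * (b - a)" for n
  proof (induction n)
    case 0
    then show ?case using assms by auto
  next
    case (Suc n)
    then obtain a' b' where ab: "-1 \<le> a'" "a' \<le> b'" "b' \<le> 1" "gap a' b' = 0" "b' - a' = t ^ n * (b - a)"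
      by blast
    then have "c \<notin> {a'<..<b'}" using none by auto
    from gap_ftent_uncut[OF ab(1-3) this] obtain a'' b'' where
      "-1 \<le> a''" "a'' \<le> b''" "b'' \<le> 1" "b'' - a'' = t * (b' - a')" "gap a'' b'' = t * gap a' b'" by metis
    then show ?case using ab by (auto simp: mult_ac)
  qed
  obtain n where "2 / (b - a) < t ^ n" using real_arch_pow t_gt_1 by blast
  then have "2 < t ^ n * (b - a)" using assms by (simp add: field_simps)
  with grow[of n] show False by auto
qed

end

theorem (in expanding_tent) invariant_set_trivial:
  assumes A: "A \<in> sets borel"
    and inv: "\<And>x. x \<in> {-1..1} \<Longrightarrow> ftent t x \<in> A \<longleftrightarrow> x \<in> A"
  shows "emeasure lborel (A \<inter> {-1..1}) = 0 \<or> emeasure lborel ({-1..1} - A) = 0"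
proof (rule ccontr)
  assume neg: "\<not> ?thesis"
  interpret A: tent_invariant_set t A using A inv by unfold_locales auto
  \<comment> \<open>Two-sided invariance passes to the complement. Each of the two sets then fills
    an interval around \<open>c\<close>, and the overlap of these intervals would be null in spite
    of its positive length.\<close>
  interpret C: tent_invariant_set t "- A" using A inv by unfold_locales auto
  obtain a b where ab: "a < c" "c < b" "A.gap a b = 0"
    using A.exists_full_interval A.full_interval_reaches_c neg by metis
  obtain a' b' where ab': "a' < c" "c < b'" "C.gap a' b' = 0"
    using C.exists_full_interval C.full_interval_reaches_c neg
    by (metis Diff_eq inf_commute)
  have neg1: "negligible ({a..b} - A)" 
    using ab(3) A.gap_sets by (simp add: A.gap_def negligible_iff_measure0)
  have neg2: "negligible ({a'..b'} - - A)"
    using ab'(3) C.gap_sets by (simp add: C.gap_def negligible_iff_measure0)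
  have "negligible {max a a'..min b b'}"
    by (rule negligible_subset[OF negligible_Un[OF neg1 neg2]]) auto
  moreover have "max a a' < min b b'" using ab ab' by auto
  ultimately show False by (metis box_real(2) negligible_interval(1) box_eq_empty(1) box_real(1) greaterThanLessThan_empty_iff linorder_not_le)
qed

section \<open>Birkhoff's theorem for ergodic maps\<close>

locale measure_preserving = finite_measure M for M :: "'a measure" +
  fixes T :: "'a \<Rightarrow> 'a"
  assumes T_measurable [measurable]: "T \<in> measurable M M"
    and T_preserves: "distr M M T = M"
begin

lemma T_space: "x \<in> space M \<Longrightarrow> T x \<in> space M"
  using T_measurable by (rule measurable_space)

lemma integrable_comp_T: "integrable M g \<Longrightarrow> integrable M (\<lambda>x. g (T x))"
  for g :: "'a \<Rightarrow> real"
  using integrable_distr[OF T_measurable, of g] T_preserves by simp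

lemma integral_comp_T:
  fixes g :: "'a \<Rightarrow> real"
  assumes "g \<in> borel_measurable M"
  shows "(\<integral>x. g (T x) \<partial>M) = (\<integral>x. g x \<partial>M)"
  using integral_distr[OF T_measurable assms] T_preserves by simp

text \<open>The maximum of the sums of \<open>g\<close> along the first 0, 1, ..., n points of the
  orbit. The recursion through \<open>T x\<close> is the identity on which Garsia's argument
  rests.\<close>

primrec max_sum :: "('a \<Rightarrow> real) \<Rightarrow> nat \<Rightarrow> 'a \<Rightarrow> real" where
  "max_sum g 0 x = 0"
| "max_sum g (Suc n) x = max 0 (g x + max_sum g n (T x))"

lemma max_sum_nonneg: "0 \<le> max_sum g n x"
  by (cases n) auto

lemma max_sum_Suc_mono: "max_sum g n x \<le> max_sum g (Suc n) x"
proof (induction n arbitrary: x)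
  case (Suc n)
  show ?case using Suc[of "T x"] by (simp add: max_def)
qed simp

lemma max_sum_mono: "n \<le> m \<Longrightarrow> max_sum g n x \<le> max_sum g m x"
  using lift_Suc_mono_le[of "\<lambda>n. max_sum g n x"] max_sum_Suc_mono by blast

lemma sum_le_max_sum: "(\<Sum>i<n. g ((T ^^ i) x)) \<le> max_sum g n x"
proof (induction n arbitrary: x)
  case (Suc n)
  have "(\<Sum>i<Suc n. g ((T ^^ i) x)) = g x + (\<Sum>i<n. g ((T ^^ i) (T x)))"
    by (subst sum.lessThan_Suc_shift) (simp add: funpow_swap1)
  then show ?case using Suc[of "T x"] by simp
qed simp

lemma integrable_max_sum:
  assumes "integrable M g" shows "integrable M (max_sum g n)"
proof (induction n)
  case (Suc n)
  show ?case using integrable_comp_T[OF Suc] assms by simp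
qed simp

text \<open>\<open>A\<close> is where the orbit sums are unbounded above, which one step of
  \<open>T\<close> does not affect. The difference
  \<open>max_sum g (Suc n) x - max_sum g n (T x)\<close> equals
  \<open>max (- max_sum g n (T x)) (g x)\<close>: it is dominated by the absolute value of
  \<open>g\<close> and eventually equals \<open>g x\<close> on \<open>A\<close>. By invariance its
  integral over \<open>A\<close> is that of \<open>max_sum g (Suc n) - max_sum g n\<close>, hence
  nonnegative.\<close>

lemma maximal_ergodic:
  assumes g: "integrable M g"
  defines "A \<equiv> {x \<in> space M. \<forall>k::nat. \<exists>n. real k < max_sum g n x}"
  shows "A \<in> sets M" "x \<in> space M \<Longrightarrow> T x \<in> A \<longleftrightarrow> x \<in> A" "0 \<le> (\<integral>x. indicator A x * g x \<partial>M)"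
proof -
  note int = integrable_max_sum[OF g]
  have [measurable]: "max_sum g n \<in> borel_measurable M" for n
    using int by (rule borel_measurable_integrable)
  have [measurable]: "g \<in> borel_measurable M"
    using g by (rule borel_measurable_integrable)
  show A_sets [measurable]: "A \<in> sets M" unfolding A_def by measurable
  show inv: "T x \<in> A \<longleftrightarrow> x \<in> A" if x: "x \<in> space M" for x
  proof
    assume Tx: "T x \<in> A"
    have "\<exists>n. real k < max_sum g n x" for k
    proof -
      obtain l :: nat where l: "real k - g x \<le> real l" using real_arch_simple by blast
      from Tx obtain n where "real l < max_sum g n (T x)" by (auto simp: A_def)
      with l have "real k < max_sum g (Suc n) x" by simp
      then show ?thesis by blast
    qed
    with x show "x \<in> A" by (simp add: A_def)
  next
    assume xA: "x \<in> A"
    have "\<exists>n. real k < max_sum g n (T x)" for k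
    proof -
      obtain l :: nat where l: "real k + \<bar>g x\<bar> \<le> real l" using real_arch_simple by blast
      from xA obtain n where "real l < max_sum g n x" by (auto simp: A_def)
      then have "real l < max_sum g (Suc n) x" using max_sum_Suc_mono[of g n x] by linarith
      with l have "real k < max_sum g n (T x)" by (auto simp: max_def split: if_splits)
      then show ?thesis by blast
    qed
    with x T_space show "T x \<in> A" by (simp add: A_def)
  qed
  let ?f = "\<lambda>n x. indicator A x * (max_sum g (Suc n) x - max_sum g n (T x))"
  have f_eq: "?f n x = indicator A x * max (- max_sum g n (T x)) (g x)" for n x
    by (simp add: max_def algebra_simps)
  have lim: "(\<lambda>n. \<integral>x. ?f n x \<partial>M) \<longlonglongrightarrow> (\<integral>x. indicator A x * g x \<partial>M)"
  proof (rule integral_dominated_convergence[where w = "\<lambda>x. \<bar>g x\<bar>"])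
    show "integrable M (\<lambda>x. \<bar>g x\<bar>)" using g by simp
    show "AE x in M. (\<lambda>n. ?f n x) \<longlonglongrightarrow> indicator A x * g x"
    proof (rule AE_I2)
      fix x assume x: "x \<in> space M"
      show "(\<lambda>n. ?f n x) \<longlonglongrightarrow> indicator A x * g x"
      proof (cases "x \<in> A")
        case True
        with inv x have "T x \<in> A" by simp
        obtain l :: nat where l: "\<bar>g x\<bar> \<le> real l" using real_arch_simple by blast
        with \<open>T x \<in> A\<close> obtain N where "real l < max_sum g N (T x)" by (auto simp: A_def)
        then have "?f n x = indicator A x * g x" if "N \<le> n" for n
          unfolding f_eq using max_sum_mono[OF that, of g "T x"] l by (simp add: max_def)
        then show ?thesis
          by (intro tendsto_eventually eventually_sequentiallyI)
      qed simp
    qed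
    show "AE x in M. norm (?f n x) \<le> \<bar>g x\<bar>" for n
    proof (rule AE_I2)
      fix x
      show "norm (?f n x) \<le> \<bar>g x\<bar>"
        unfolding f_eq using max_sum_nonneg[of g n "T x"] by (auto simp: indicator_def max_def)
    qed
  qed measurable
  have "0 \<le> (\<integral>x. ?f n x \<partial>M)" for n
  proof -
    have ind: "integrable M (\<lambda>x. indicator A x * max_sum g m x)" for m
      using integrable_mult_indicator[OF A_sets int[of m]] by simp
    \<comment> \<open>Invariance replaces \<open>indicator A x\<close> by
      \<open>indicator A (T x)\<close>, so that the second term becomes a function of
      \<open>T x\<close> and measure preservation applies.\<close>
    have "(\<integral>x. ?f n x \<partial>M) = (\<integral>x. indicator A x * max_sum g (Suc n) x - indicator A (T x) * max_sum g n (T x) \<partial>M)"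
      using inv by (intro Bochner_Integration.integral_cong) (auto simp: indicator_def)
    also have "\<dots> = (\<integral>x. indicator A x * max_sum g (Suc n) x \<partial>M) - (\<integral>x. indicator A (T x) * max_sum g n (T x) \<partial>M)"
      by (intro Bochner_Integration.integral_diff ind integrable_comp_T[OF ind])
    also have "(\<integral>x. indicator A (T x) * max_sum g n (T x) \<partial>M) = (\<integral>x. indicator A x * max_sum g n x \<partial>M)"
      by (rule integral_comp_T) measurable
    finally have eq: "(\<integral>x. ?f n x \<partial>M) = (\<integral>x. indicator A x * max_sum g (Suc n) x \<partial>M) - (\<integral>x. indicator A x * max_sum g n x \<partial>M)" .
    have "(\<integral>x. indicator A x * max_sum g n x \<partial>M) \<le> (\<integral>x. indicator A x * max_sum g (Suc n) x \<partial>M)"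
      by (intro integral_mono ind mult_left_mono max_sum_Suc_mono) auto
    then show ?thesis unfolding eq by simp
  qed
  then show "0 \<le> (\<integral>x. indicator A x * g x \<partial>M)"
    by (intro LIMSEQ_le_const[OF lim]) auto
qed

end

section \<open>The pointwise ergodic theorem\<close>

locale ergodic = measure_preserving +
  assumes invariant_trivial: "\<And>A. A \<in> sets M \<Longrightarrow> (\<And>x. x \<in> space M \<Longrightarrow> T x \<in> A \<longleftrightarrow> x \<in> A) \<Longrightarrow>
      emeasure M A = 0 \<or> emeasure M (space M - A) = 0"
    and total_mass: "emeasure M (space M) = 1"
begin

text \<open>The invariant set of unbounded sums is null or of full measure; in the latter case the
  maximal inequality would make the integral of \<open>g\<close> nonnegative.\<close>

lemma AE_sums_bounded_above:
  fixes g :: "'a \<Rightarrow> real"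
  assumes g: "integrable M g" and neg: "(\<integral>x. g x \<partial>M) < 0"
  shows "AE x in M. \<exists>C. \<forall>n. (\<Sum>i<n. g ((T ^^ i) x)) \<le> C"
proof -
  let ?A = "{x \<in> space M. \<forall>k::nat. \<exists>n. real k < max_sum g n x}"
  have "emeasure M (space M - ?A) \<noteq> 0"
  proof
    assume "emeasure M (space M - ?A) = 0"
    then have "AE x in M. x \<notin> space M - ?A"
      by (intro AE_not_in null_setsI sets.Diff maximal_ergodic(1)[OF g]) auto
    then have "(\<integral>x. indicator ?A x * g x \<partial>M) = (\<integral>x. g x \<partial>M)"
      using g maximal_ergodic(1)[OF g]
      by (intro integral_cong_AE borel_measurable_times borel_measurable_indicator)
        (auto simp: indicator_def elim!: AE_mp)
    with maximal_ergodic(3)[OF g] neg show False by simp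
  qed
  then have "emeasure M ?A = 0"
    using invariant_trivial[OF maximal_ergodic(1,2)[OF g]] by blast
  then have "AE x in M. x \<notin> ?A"
    by (intro AE_not_in null_setsI maximal_ergodic(1)[OF g])
  then show ?thesis
  proof (rule AE_mp, intro AE_I2 impI)
    fix x assume "x \<in> space M" "x \<notin> ?A"
    then obtain k :: nat where "\<forall>n. max_sum g n x \<le> real k" by (auto simp: not_less)
    then show "\<exists>C. \<forall>n. (\<Sum>i<n. g ((T ^^ i) x)) \<le> C"
      using sum_le_max_sum order_trans by blast
  qed
qed

text \<open>Subtracting a constant just above the mean makes the integral negative. The slacks
  \<open>inverse (real (Suc j))\<close> are countably many, so one null set serves all of
  them.\<close>

lemma AE_sums_le:
  fixes g :: "'a \<Rightarrow> real"
  assumes g: "integrable M g"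
  shows "AE x in M. \<forall>j. \<exists>C. \<forall>n. (\<Sum>i<n. g ((T ^^ i) x)) \<le> C + real n * ((\<integral>x. g x \<partial>M) + inverse (real (Suc j)))"
proof (subst AE_all_countable, rule allI)
  fix j
  let ?k = "(\<integral>x. g x \<partial>M) + inverse (real (Suc j))"
  have "(\<integral>x. g x - ?k \<partial>M) = (\<integral>x. g x \<partial>M) - ?k"
    using g total_mass by (subst Bochner_Integration.integral_diff) (auto simp: measure_def)
  then have "(\<integral>x. g x - ?k \<partial>M) < 0" by simp
  then have "AE x in M. \<exists>C. \<forall>n. (\<Sum>i<n. g ((T ^^ i) x) - ?k) \<le> C"
    by (intro AE_sums_bounded_above) (use g in auto)
  then show "AE x in M. \<exists>C. \<forall>n. (\<Sum>i<n. g ((T ^^ i) x)) \<le> C + real n * ?k"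
    by (simp add: sum_subtractf algebra_simps)
qed

text \<open>The one-sided bounds for \<open>g\<close> and \<open>- g\<close> enclose the averages;
  the constants \<open>C\<close> and \<open>D\<close>, which depend on the point, vanish after
  division by \<open>n\<close>.\<close>

theorem birkhoff:
  fixes g :: "'a \<Rightarrow> real"
  assumes g: "integrable M g"
  shows "AE x in M. (\<lambda>n. (\<Sum>i<n. g ((T ^^ i) x)) / real n) \<longlonglongrightarrow> (\<integral>x. g x \<partial>M)"
proof -
  let ?I = "\<integral>x. g x \<partial>M"
  have upper: "AE x in M. \<forall>j. \<exists>C. \<forall>n. (\<Sum>i<n. g ((T ^^ i) x)) \<le> C + real n * (?I + inverse (real (Suc j)))"
    by (rule AE_sums_le[OF g])
  have lower: "AE x in M. \<forall>j. \<exists>C. \<forall>n. - (\<Sum>i<n. g ((T ^^ i) x)) \<le> C + real n * (- ?I + inverse (real (Suc j)))"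
    using AE_sums_le[of "\<lambda>x. - g x"] g by (simp add: sum_negf)
  from upper lower show ?thesis
  proof eventually_elim
    case (elim x)
    let ?S = "\<lambda>n. \<Sum>i<n. g ((T ^^ i) x)"
    show ?case
    proof (rule LIMSEQ_I)
      fix r :: real assume "0 < r"
      then obtain j where j: "inverse (real (Suc j)) < r / 2" using reals_Archimedean[of "r / 2"] by auto
      obtain C where C: "\<And>n. ?S n \<le> C + real n * (?I + inverse (real (Suc j)))" using elim(1) by blast
      obtain D where D: "\<And>n. - ?S n \<le> D + real n * (- ?I + inverse (real (Suc j)))" using elim(2) by blast
      \<comment> \<open>Beyond \<open>N\<close> the constants contribute less than
        \<open>r / 2\<close> to the average, as does the slack.\<close>
      obtain N :: nat where N: "2 * (\<bar>C\<bar> + \<bar>D\<bar>) / r < real N" using reals_Archimedean2 by blast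
      have "norm (?S n / real n - ?I) < r" if "Suc N \<le> n" for n
      proof -
        have "2 * (\<bar>C\<bar> + \<bar>D\<bar>) < real N * r"
          using N \<open>0 < r\<close> by (simp add: divide_less_eq)
        also have "\<dots> \<le> real n * r"
          using that \<open>0 < r\<close> by (intro mult_right_mono) auto
        finally have n: "0 < real n" "2 * (\<bar>C\<bar> + \<bar>D\<bar>) < real n * r" using that by auto
        have "real n * inverse (real (Suc j)) \<le> real n * (r / 2)"
          using j n by (intro mult_left_mono) auto
        then have "\<bar>?S n - real n * ?I\<bar> < real n * r"
          using C[of n] D[of n] n unfolding distrib_left mult_minus_right by (simp only: abs_less_iff) linarith
        then have "\<bar>?S n - real n * ?I\<bar> / real n < r" using n by (simp add: divide_simps mult.commute)
        moreover have "?S n / real n - ?I = (?S n - real n * ?I) / real n" using n by (simp add: field_simps)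
        ultimately show ?thesis using n by (simp add: abs_divide)
      qed
      then show "\<exists>no. \<forall>n\<ge>no. norm (?S n / real n - ?I) < r" by blast
    qed
  qed
qed

end

section \<open>The disk\<close>

text \<open>The level curves of \<open>s\<close> are nested ellipses with semi-axes
  \<open>2 - s\<close> and \<open>2 * (1 - s)\<close>. For s < s' a common point would give
  \<open>cos y = p * cos y'\<close> and \<open>sin y = q * sin y'\<close> with factors below 1,
  against the sum of squares being 1. At \<open>s = 1\<close> the ellipse collapses to I and only
  the cosine survives.\<close>

lemma cc_inject:
  assumes eq: "cc y s = cc y' s'" and s: "0 \<le> s" "s \<le> 1" "0 \<le> s'" "s' \<le> 1"
  shows "s = s'" "cos y = cos y'" "s < 1 \<Longrightarrow> sin y = sin y'"
proof -
  have not_less: "\<not> s < s'" if eq: "cc y s = cc y' s'" and s: "0 \<le> s" "s' \<le> 1" for y s y' s'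
  proof
    assume less: "s < s'"
    define p q where "p = (2 - s') / (2 - s)" and "q = (1 - s') / (1 - s)"
    have "cos y = p * cos y'" "sin y = q * sin y'"
      using eq less s by (auto simp: cc_def p_def q_def field_simps)
    then have "1 = p\<^sup>2 * (cos y')\<^sup>2 + q\<^sup>2 * (sin y')\<^sup>2"
      using sin_cos_squared_add[of y] by (simp add: power_mult_distrib)
    moreover have pq: "p\<^sup>2 < 1" "q\<^sup>2 < 1"
      using less s by (auto simp: p_def q_def abs_square_less_1)
    moreover have "p\<^sup>2 * (cos y')\<^sup>2 \<le> (cos y')\<^sup>2" "q\<^sup>2 * (sin y')\<^sup>2 \<le> (sin y')\<^sup>2"
      using pq by (auto intro!: mult_left_le_one_le)
    moreover have "(cos y')\<^sup>2 + (sin y')\<^sup>2 = 1" by simp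
    \<comment> \<open>Cosine and sine do not vanish together, so one of the two bounds is
      strict.\<close>
    moreover have "p\<^sup>2 * (cos y')\<^sup>2 < (cos y')\<^sup>2 \<or> q\<^sup>2 * (sin y')\<^sup>2 < (sin y')\<^sup>2"
    proof (cases "cos y' = 0")
      case True
      then have "(sin y')\<^sup>2 = 1" using sin_cos_squared_add[of y'] by simp
      with pq show ?thesis by simp
    next
      case False
      with pq show ?thesis by simp
    qed
    ultimately show False by linarith
  qed
  show ss: "s = s'"
    using not_less[OF eq] not_less[OF eq[symmetric]] s by linarith
  show "cos y = cos y'" "s < 1 \<Longrightarrow> sin y = sin y'"
    using eq s unfolding cc_def ss by auto
qed

text \<open>The choice in \<open>Ups\<close> is unambiguous: for s < 1 the point determines sine and
  cosine of the angle, and at \<open>s = 1\<close> the value depends on the cosine alone.\<close>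

lemma Ups_cc:
  assumes "0 \<le> s" "s \<le> 1" shows "Ups (cc y s) = cc y (min 1 (2 * s))"
  unfolding Ups_def
proof (rule some_equality)
  fix w assume "\<exists>y' s'. 0 \<le> s' \<and> s' \<le> 1 \<and> cc y s = cc y' s' \<and> w = cc y' (min 1 (2 * s'))"
  then obtain y' s' where *: "0 \<le> s'" "s' \<le> 1" "cc y s = cc y' s'" "w = cc y' (min 1 (2 * s'))"
    by blast
  show "w = cc y (min 1 (2 * s))"
    using cc_inject[OF *(3) assms *(1,2)] *(4) by (cases "s < 1") (auto simp: cc_def)
qed (use assms in blast)

lemma cc_continuous: "continuous_on S (\<lambda>p. cc (fst p) (snd p))"
  unfolding cc_def by (intro continuous_intros)

lemma Dsk_eq: "Dsk = (\<lambda>p. cc (fst p) (snd p)) ` ({0..2 * pi} \<times> {0..1})"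
proof -
  have "cc y s \<in> (\<lambda>p. cc (fst p) (snd p)) ` ({0..2 * pi} \<times> {0..1})" if "s \<in> {0..1}" for y s
  proof -
    obtain y' where "0 \<le> y'" "y' < 2 * pi" "cos y = cos y'" "sin y = sin y'"
      using sincos_total_2pi[of "cos y" "sin y"] by auto
    then show ?thesis
      using that by (intro image_eqI[of _ _ "(y', s)"]) (auto simp: cc_def)
  qed
  then show ?thesis by (auto simp: Dsk_def)
qed

lemma cc_in_Dsk: "0 \<le> s \<Longrightarrow> s \<le> 1 \<Longrightarrow> cc y s \<in> Dsk"
  by (auto simp: Dsk_def)

lemma compact_Dsk: "compact Dsk"
  unfolding Dsk_eq by (intro compact_continuous_image cc_continuous compact_Times) auto

lemma Ups_in_Dsk: "z \<in> Dsk \<Longrightarrow> Ups z \<in> Dsk"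
  by (auto simp: Dsk_def Ups_cc intro!: cc_in_Dsk[unfolded Dsk_def])

text \<open>The coordinates are not injective over I, so continuity is obtained from the graph: it
  is a continuous image of the coordinate rectangle, hence compact.\<close>

lemma continuous_on_Ups: "continuous_on Dsk Ups"
proof (rule continuous_from_closed_graph[OF compact_Dsk])
  show "Ups \<in> Dsk \<rightarrow> Dsk" using Ups_in_Dsk by blast
  have "(\<lambda>z. (z, Ups z)) ` Dsk =
      (\<lambda>p. (cc (fst p) (snd p), cc (fst p) (min 1 (2 * snd p)))) ` ({0..2 * pi} \<times> {0..1})"
    unfolding Dsk_eq image_image by (intro image_cong) (auto simp: Ups_cc)
  moreover have "compact \<dots>"
    unfolding cc_def by (intro compact_continuous_image compact_Times continuous_intros) auto
  ultimately show "closed ((\<lambda>z. (z, Ups z)) ` Dsk)" by (metis compact_imp_closed)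
qed

lemma complex_of_real_eq_cc:
  assumes "x \<in> {-1..1}" shows "complex_of_real x = cc (arccos x) 1"
  using assms by (simp add: cc_def complex_eq_iff)

lemma of_real_in_Dsk: "x \<in> {-1..1} \<Longrightarrow> complex_of_real x \<in> Dsk"
  by (simp add: complex_of_real_eq_cc cc_in_Dsk)

section \<open>Regular points\<close>

lemma AE_in_full_set:
  assumes "sets M = sets borel" "emeasure M UNIV = 1" "emeasure M A = 1"
  shows "AE x in M. x \<in> A"
proof -
  have "A \<in> sets M" using assms(3) emeasure_notin_sets[of A M] by fastforce
  moreover have "space M = UNIV" using assms(1) sets_eq_imp_space_eq by fastforce
  ultimately have "emeasure M (space M - A) = 0"
    using assms by (subst emeasure_compl) auto
  then have "AE x in M. x \<notin> space M - A"
    using \<open>A \<in> sets M\<close> by (intro AE_not_in null_setsI) auto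
  then show ?thesis using \<open>space M = UNIV\<close> by simp
qed

text \<open>The condition in \<open>regular_pt\<close> for one test function, isolated so that it
  can be checked on a dense class.\<close>

definition averages_converge ::
  "'a::topological_space set \<Rightarrow> ('a \<Rightarrow> 'a) \<Rightarrow> 'a measure \<Rightarrow> 'a \<Rightarrow> ('a \<Rightarrow> real) \<Rightarrow> bool" where
  "averages_converge M f \<nu> x \<alpha> \<longleftrightarrow>
     (\<lambda>n. (\<Sum>i<n. \<alpha> ((f ^^ i) x)) / real n) \<longlonglongrightarrow> integral\<^sup>L (restrict_space \<nu> M) \<alpha>"

lemma funpow_in: "f ` M \<subseteq> M \<Longrightarrow> x \<in> M \<Longrightarrow> (f ^^ i) x \<in> M"
  by (induction i) auto

lemma integrable_restrict_space_compact:
  fixes \<alpha> :: "'a::topological_space \<Rightarrow> real"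
  assumes "sets \<nu> = sets borel" "emeasure \<nu> M = 1" "compact M" "continuous_on M \<alpha>"
  shows "integrable (restrict_space \<nu> M) \<alpha>"
proof -
  have M: "M \<in> sets \<nu>" using assms(2) emeasure_notin_sets[of M \<nu>] by fastforce
  then have "emeasure (restrict_space \<nu> M) (space (restrict_space \<nu> M)) = 1"
    using assms(2) sets.sets_into_space[OF M]
    by (simp add: emeasure_restrict_space space_restrict_space Int_absorb2)
  then interpret finite_measure "restrict_space \<nu> M" by (intro finite_measureI) auto
  obtain C where C: "\<And>z. z \<in> M \<Longrightarrow> norm (\<alpha> z) \<le> C"
    using compact_imp_bounded[OF compact_continuous_image[OF assms(4,3)]]
    by (auto simp: bounded_iff)
  show ?thesis
  proof (rule integrable_const_bound[where B = C])
    show "AE z in restrict_space \<nu> M. norm (\<alpha> z) \<le> C"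
      using C by (intro AE_I2) (auto simp: space_restrict_space)
    show "\<alpha> \<in> borel_measurable (restrict_space \<nu> M)"
      using borel_measurable_continuous_on_restrict[OF assms(4)]
      by (simp only: measurable_cong_sets[OF sets_restrict_space_cong[OF assms(1)] refl])
  qed
qed

text \<open>A three-epsilon argument: since the orbit stays in \<open>M\<close> and \<nu> has mass 1
  on \<open>M\<close>, a uniformly close test function changes all averages and the integral by
  little.\<close>

lemma regular_ptI:
  assumes \<nu>: "sets \<nu> = sets borel" "emeasure \<nu> M = 1"
    and M: "compact M" "f ` M \<subseteq> M" "x \<in> M"
    and approx: "\<And>\<alpha> e. continuous_on M \<alpha> \<Longrightarrow> 0 < e \<Longrightarrow>
      \<exists>\<beta>. continuous_on M \<beta> \<and> (\<forall>z\<in>M. \<bar>\<alpha> z - \<beta> z\<bar> < e) \<and> averages_converge M f \<nu> x \<beta>"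
  shows "regular_pt M f \<nu> x"
  unfolding regular_pt_def
proof (intro conjI allI impI)
  fix \<alpha> :: "'a \<Rightarrow> real" assume \<alpha>: "continuous_on M \<alpha>"
  let ?N = "restrict_space \<nu> M"
  show "(\<lambda>n. (\<Sum>i<n. \<alpha> ((f ^^ i) x)) / real n) \<longlonglongrightarrow> integral\<^sup>L ?N \<alpha>"
  proof (rule LIMSEQ_I)
    fix e :: real assume "0 < e"
    then obtain \<beta> where \<beta>: "continuous_on M \<beta>" "\<And>z. z \<in> M \<Longrightarrow> \<bar>\<alpha> z - \<beta> z\<bar> < e / 3"
      "averages_converge M f \<nu> x \<beta>"
      using approx[OF \<alpha>, of "e / 3"] by auto
    from \<beta>(3) obtain n0 where n0: "\<And>n. n0 \<le> n \<Longrightarrow> \<bar>(\<Sum>i<n. \<beta> ((f ^^ i) x)) / real n - integral\<^sup>L ?N \<beta>\<bar> < e / 3"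
      unfolding averages_converge_def using \<open>0 < e\<close> by (force dest!: LIMSEQ_D[of _ _ "e / 3"])
    have Mset: "M \<in> sets \<nu>" using \<nu>(2) emeasure_notin_sets[of M \<nu>] by fastforce
    have int_le: "\<bar>integral\<^sup>L ?N \<alpha> - integral\<^sup>L ?N \<beta>\<bar> \<le> e / 3"
    proof -
      note int = integrable_restrict_space_compact[OF \<nu> M(1) \<alpha>]
        integrable_restrict_space_compact[OF \<nu> M(1) \<beta>(1)]
      have "\<bar>\<integral>z. \<alpha> z - \<beta> z \<partial>?N\<bar> \<le> (\<integral>z. \<bar>\<alpha> z - \<beta> z\<bar> \<partial>?N)"
        by (rule integral_abs_bound)
      also have "\<dots> \<le> (\<integral>z. e / 3 \<partial>?N)"
      proof (rule integral_mono)
        have "emeasure ?N (space ?N) = 1"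
          using \<nu>(2) sets.sets_into_space[OF Mset] Mset
          by (simp add: emeasure_restrict_space space_restrict_space Int_absorb2)
        then show "integrable ?N (\<lambda>z. e / 3)"
          by (intro finite_measure.integrable_const finite_measureI) simp
      qed (use int \<beta>(2) in \<open>auto simp: space_restrict_space less_imp_le\<close>)
      also have "\<dots> = e / 3"
        using \<nu>(2) sets.sets_into_space[OF Mset] Mset
        by (simp add: measure_def emeasure_restrict_space space_restrict_space Int_absorb2)
      finally show ?thesis using int by simp
    qed
    have avg: "\<bar>(\<Sum>i<n. \<alpha> ((f ^^ i) x)) / real n - (\<Sum>i<n. \<beta> ((f ^^ i) x)) / real n\<bar> \<le> e / 3" for n
    proof (cases "n = 0")
      case False
      have "\<bar>\<Sum>i<n. \<alpha> ((f ^^ i) x) - \<beta> ((f ^^ i) x)\<bar> \<le> (\<Sum>i<n. \<bar>\<alpha> ((f ^^ i) x) - \<beta> ((f ^^ i) x)\<bar>)"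
        by (rule sum_abs)
      also have "\<dots> \<le> (\<Sum>i<n. e / 3)"
        by (intro sum_mono less_imp_le \<beta>(2) funpow_in M)
      finally show ?thesis
        using False by (simp add: sum_subtractf divide_simps abs_divide flip: diff_divide_distrib) (simp add: mult.commute)
    qed (use \<open>0 < e\<close> in simp)
    have "\<bar>(\<Sum>i<n. \<alpha> ((f ^^ i) x)) / real n - integral\<^sup>L ?N \<alpha>\<bar> < e" if "n0 \<le> n" for n
    proof -
      have "e / 3 + e / 3 + e / 3 = e" by simp
      with avg[of n] int_le n0[OF that] show ?thesis by linarith
    qed
    then show "\<exists>n0. \<forall>n\<ge>n0. norm ((\<Sum>i<n. \<alpha> ((f ^^ i) x)) / real n - integral\<^sup>L ?N \<alpha>) < e"
      by auto
  qed
qed (rule M)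

text \<open>The averages from \<open>x\<close> and from \<open>f x\<close> differ by one term of
  weight 1/(n+1) and by the factor n/(n+1).\<close>

lemma regular_pt_preimage:
  assumes "regular_pt M f \<nu> (f x)" "x \<in> M"
  shows "regular_pt M f \<nu> x"
  unfolding regular_pt_def
proof (intro conjI allI impI)
  fix \<alpha> :: "'a \<Rightarrow> real" assume "continuous_on M \<alpha>"
  with assms(1) have lim: "(\<lambda>n. (\<Sum>i<n. \<alpha> ((f ^^ i) (f x))) / real n) \<longlonglongrightarrow> integral\<^sup>L (restrict_space \<nu> M) \<alpha>"
    by (simp add: regular_pt_def)
  have "(\<lambda>n. \<alpha> x * inverse (real (Suc n)) +
        (\<Sum>i<n. \<alpha> ((f ^^ i) (f x))) / real n * (real n / real (Suc n)))
      \<longlonglongrightarrow> \<alpha> x * 0 + integral\<^sup>L (restrict_space \<nu> M) \<alpha> * 1"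
    by (intro tendsto_add tendsto_mult tendsto_const lim LIMSEQ_inverse_real_of_nat LIMSEQ_n_over_Suc_n)
  moreover have "\<alpha> x * inverse (real (Suc n)) +
        (\<Sum>i<n. \<alpha> ((f ^^ i) (f x))) / real n * (real n / real (Suc n))
      = (\<Sum>i<Suc n. \<alpha> ((f ^^ i) x)) / real (Suc n)" for n
    by (subst sum.lessThan_Suc_shift, cases "n = 0")
      (auto simp: funpow_swap1 divide_inverse distrib_right)
  ultimately have "(\<lambda>n. (\<Sum>i<Suc n. \<alpha> ((f ^^ i) x)) / real (Suc n)) \<longlonglongrightarrow> integral\<^sup>L (restrict_space \<nu> M) \<alpha>"
    by simp
  then show "(\<lambda>n. (\<Sum>i<n. \<alpha> ((f ^^ i) x)) / real n) \<longlonglongrightarrow> integral\<^sup>L (restrict_space \<nu> M) \<alpha>"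
    by (rule LIMSEQ_imp_Suc)
qed (rule assms)

lemma regular_pt_funpow_preimage:
  assumes "regular_pt M f \<nu> ((f ^^ k) x)" "x \<in> M" "f ` M \<subseteq> M"
  shows "regular_pt M f \<nu> x"
  using assms(1,2)
proof (induction k arbitrary: x)
  case (Suc k)
  have "f x \<in> M" using Suc.prems assms(3) by auto
  then have "regular_pt M f \<nu> (f x)"
    using Suc.IH[of "f x"] Suc.prems by (simp add: funpow_swap1)
  then show ?case using regular_pt_preimage Suc.prems by blast
qed simp

text \<open>A change of variables between restricted measures: \<open>m\<close> lives on
  \<open>M\<close> and \<open>p\<close> maps \<open>M\<close> into \<open>N\<close>, so both
  indicators are 1 almost everywhere. It serves for the inclusion of I in the disk and for the
  coordinates of the inverse limit.\<close>

lemma integral_restrict_distr: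
  fixes \<alpha> :: "'b::topological_space \<Rightarrow> real" and p :: "'a::topological_space \<Rightarrow> 'b"
  assumes m: "sets m = sets borel" "emeasure m UNIV = 1" "emeasure m M = 1"
    and p: "p \<in> borel_measurable borel" "p ` M \<subseteq> N"
    and N: "N \<in> sets borel" "continuous_on N \<alpha>"
    and \<alpha>p: "continuous_on M (\<lambda>x. \<alpha> (p x))"
  shows "integral\<^sup>L (restrict_space (distr m borel p) N) \<alpha> = integral\<^sup>L (restrict_space m M) (\<lambda>x. \<alpha> (p x))"
proof -
  have M: "M \<in> sets borel" using m emeasure_notin_sets[of M m] by fastforce
  have sp: "space m = UNIV" using m(1) sets_eq_imp_space_eq by fastforce
  have pm: "p \<in> measurable m borel" using p(1) m(1) by (simp cong: measurable_cong_sets)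
  have \<alpha>m: "(\<lambda>z. indicator N z *\<^sub>R \<alpha> z) \<in> borel_measurable borel"
    by (rule borel_measurable_continuous_on_indicator[OF N])
  have "integral\<^sup>L (restrict_space (distr m borel p) N) \<alpha> = (\<integral>z. indicator N z *\<^sub>R \<alpha> z \<partial>distr m borel p)"
    using N by (intro integral_restrict_space) simp
  also have "\<dots> = (\<integral>x. indicator N (p x) *\<^sub>R \<alpha> (p x) \<partial>m)"
    by (rule integral_distr[OF pm \<alpha>m])
  also have "\<dots> = (\<integral>x. indicator M x *\<^sub>R \<alpha> (p x) \<partial>m)"
  proof (rule integral_cong_AE)
    show "(\<lambda>x. indicator N (p x) *\<^sub>R \<alpha> (p x)) \<in> borel_measurable m"
      by (rule measurable_compose[OF pm \<alpha>m])
    show "(\<lambda>x. indicator M x *\<^sub>R \<alpha> (p x)) \<in> borel_measurable m"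
      using borel_measurable_continuous_on_indicator[OF M \<alpha>p] m(1) by (simp cong: measurable_cong_sets)
    show "AE x in m. indicator N (p x) *\<^sub>R \<alpha> (p x) = indicator M x *\<^sub>R \<alpha> (p x)"
      using AE_in_full_set[OF m] by eventually_elim (use p(2) in auto)
  qed
  also have "\<dots> = integral\<^sup>L (restrict_space m M) (\<lambda>x. \<alpha> (p x))"
    using M m(1) sp by (intro integral_restrict_space[symmetric]) simp
  finally show ?thesis .
qed

section \<open>The inverse limit\<close>

text \<open>On the inverse limit the shift acts coordinatewise as H, and a continuous function is
  uniformly close to one depending on a single coordinate, since each coordinate determines the
  earlier ones.\<close>

lemma Hhat_coordinate:
  assumes "z \<in> Dhat H" shows "Hhat H z n = H (z n)"
  using assms by (cases n) (auto simp: Hhat_def Dhat_def)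

lemma Hhat_in_Dhat:
  assumes "H ` Dsk \<subseteq> Dsk" "z \<in> Dhat H" shows "Hhat H z \<in> Dhat H"
proof -
  have "Hhat H z n \<in> Dsk" "H (Hhat H z (Suc n)) = Hhat H z n" for n
    using assms by (auto simp: Hhat_coordinate) (auto simp: Dhat_def)
  then show ?thesis by (simp add: Dhat_def)
qed

lemma Hhat_funpow_coordinate:
  assumes H: "H ` Dsk \<subseteq> Dsk" and z: "z \<in> Dhat H"
  shows "(Hhat H ^^ i) z n = (H ^^ i) (z n)"
proof (induction i)
  case (Suc i)
  have "(Hhat H ^^ i) z \<in> Dhat H"
    by (rule funpow_in) (use Hhat_in_Dhat[OF H] z in auto)
  then show ?case using Suc by (simp add: Hhat_coordinate)
qed simp

lemma Dhat_earlier_coordinate: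
  assumes "z \<in> Dhat H" shows "z n = (H ^^ k) (z (n + k))"
proof (induction k)
  case (Suc k)
  have "z (n + k) = H (z (n + Suc k))" using assms by (simp add: Dhat_def)
  then show ?case using Suc by (simp add: funpow_swap1)
qed simp

lemma continuous_on_coordinate: "continuous_on S (\<lambda>z. z n)"
  for S :: "(nat \<Rightarrow> 'b::topological_space) set"
  by (rule continuous_on_subset[OF continuous_on_product_coordinates]) simp

text \<open>The thread equations cut out a closed subset of the compact product of disks.\<close>

lemma compact_Dhat:
  assumes "continuous_on Dsk H" shows "compact (Dhat H)"
proof -
  have "compactin (product_topology (\<lambda>i. euclidean) UNIV) (PiE UNIV (\<lambda>i::nat. Dsk))"
    by (simp add: compactin_PiE compact_Dsk)
  then have K: "compact (PiE UNIV (\<lambda>i::nat. Dsk))"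
    by (simp add: euclidean_product_topology)
  let ?K = "PiE UNIV (\<lambda>i::nat. Dsk)"
  have "closed {z \<in> ?K. H (z (Suc n)) - z n = 0}" for n
    by (intro continuous_closed_preimage_constant compact_imp_closed[OF K] continuous_on_diff
        continuous_on_compose2[OF assms continuous_on_coordinate] continuous_on_coordinate) auto
  then have "closed (\<Inter>n. {z \<in> ?K. H (z (Suc n)) - z n = 0})" by (intro closed_INT) blast
  moreover have "(\<Inter>n. {z \<in> ?K. H (z (Suc n)) - z n = 0}) = Dhat H"
    by (auto simp: Dhat_def)
  ultimately have "closed (Dhat H)" by simp
  moreover have "Dhat H \<subseteq> ?K" by (auto simp: Dhat_def)
  ultimately show ?thesis using K by (metis compact_Int_closed inf.absorb_iff2)
qed

text \<open>Stone-Weierstrass for the class \<open>P\<close> of functions of one coordinate.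
  Functions of the coordinates k and m both become functions of coordinate k + m through powers of
  \<open>H\<close>, so \<open>P\<close> is an algebra; real and imaginary parts of coordinates
  separate threads.\<close>

lemma Dhat_approx_by_coordinate:
  fixes \<alpha> :: "(nat \<Rightarrow> complex) \<Rightarrow> real"
  assumes H: "continuous_on Dsk H" "H ` Dsk \<subseteq> Dsk"
    and "continuous_on (Dhat H) \<alpha>" "0 < e"
  shows "\<exists>k \<beta>. continuous_on Dsk \<beta> \<and> (\<forall>z\<in>Dhat H. \<bar>\<alpha> z - \<beta> (z k)\<bar> < e)"
proof -
  define P where "P f \<longleftrightarrow> (\<exists>k \<beta>. continuous_on Dsk \<beta> \<and> (\<forall>z\<in>Dhat H. f z = \<beta> (z k)))"
    for f :: "(nat \<Rightarrow> complex) \<Rightarrow> real"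
  have common: "\<exists>l \<beta> \<gamma>. continuous_on Dsk \<beta> \<and> continuous_on Dsk \<gamma> \<and>
      (\<forall>z\<in>Dhat H. f z = \<beta> (z l)) \<and> (\<forall>z\<in>Dhat H. g z = \<gamma> (z l))" if "P f" "P g" for f g
  proof -
    have Hk: "continuous_on Dsk (H ^^ k) \<and> (H ^^ k) ` Dsk \<subseteq> Dsk" for k
    proof (induction k)
      case (Suc k)
      then have "continuous_on Dsk (H \<circ> (H ^^ k))"
        by (intro continuous_on_compose continuous_on_subset[OF H(1)]) auto
      moreover have "(H \<circ> (H ^^ k)) ` Dsk \<subseteq> Dsk" using Suc H(2) by (auto simp: image_subset_iff)
      ultimately show ?case by simp
    qed simp
    obtain k \<beta> where 1: "continuous_on Dsk \<beta>" "\<And>z. z \<in> Dhat H \<Longrightarrow> f z = \<beta> (z k)"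
      using \<open>P f\<close> by (auto simp: P_def)
    obtain m \<gamma> where 2: "continuous_on Dsk \<gamma>" "\<And>z. z \<in> Dhat H \<Longrightarrow> g z = \<gamma> (z m)"
      using \<open>P g\<close> by (auto simp: P_def)
    have "continuous_on Dsk (\<lambda>w. \<beta> ((H ^^ m) w))"
      by (rule continuous_on_compose2[OF 1(1)]) (use Hk in auto)
    moreover have "continuous_on Dsk (\<lambda>w. \<gamma> ((H ^^ k) w))"
      by (rule continuous_on_compose2[OF 2(1)]) (use Hk in auto)
    moreover have "f z = \<beta> ((H ^^ m) (z (k + m)))" "g z = \<gamma> ((H ^^ k) (z (k + m)))" if "z \<in> Dhat H" for z
      using 1(2)[OF that] 2(2)[OF that] Dhat_earlier_coordinate[OF that, of k m]
        Dhat_earlier_coordinate[OF that, of m k] by (auto simp: add.commute)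
    ultimately show ?thesis by blast
  qed
  have "\<exists>g. P g \<and> (\<forall>z\<in>Dhat H. \<bar>\<alpha> z - g z\<bar> < e)"
  proof (rule Stone_Weierstrass_HOL[of "Dhat H" P \<alpha> e])
    show "compact (Dhat H)" by (rule compact_Dhat[OF H(1)])
    show "P (\<lambda>z. r)" for r
      unfolding P_def by (intro exI[of _ 0] exI[of _ "\<lambda>_. r"]) auto
    show "continuous_on (Dhat H) f" if "P f" for f
    proof -
      obtain k \<beta> where 1: "continuous_on Dsk \<beta>" "\<And>z. z \<in> Dhat H \<Longrightarrow> f z = \<beta> (z k)"
        using \<open>P f\<close> by (auto simp: P_def)
      have "continuous_on (Dhat H) (\<lambda>z. \<beta> (z k))"
        by (rule continuous_on_compose2[OF 1(1) continuous_on_coordinate]) (auto simp: Dhat_def)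
      then show ?thesis using 1(2) by (metis (no_types, lifting) continuous_on_cong)
    qed
    show "P (\<lambda>z. f z + g z)" if fg: "P f \<and> P g" for f g
    proof -
      obtain l \<beta> \<gamma> where "continuous_on Dsk \<beta>" "continuous_on Dsk \<gamma>"
        "\<forall>z\<in>Dhat H. f z = \<beta> (z l)" "\<forall>z\<in>Dhat H. g z = \<gamma> (z l)" using common fg by blast
      then show ?thesis
        unfolding P_def by (intro exI[of _ l] exI[of _ "\<lambda>w. \<beta> w + \<gamma> w"]) (auto intro: continuous_on_add)
    qed
    show "P (\<lambda>z. f z * g z)" if fg: "P f \<and> P g" for f g
    proof -
      obtain l \<beta> \<gamma> where "continuous_on Dsk \<beta>" "continuous_on Dsk \<gamma>"
        "\<forall>z\<in>Dhat H. f z = \<beta> (z l)" "\<forall>z\<in>Dhat H. g z = \<gamma> (z l)" using common fg by blast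
      then show ?thesis
        unfolding P_def by (intro exI[of _ l] exI[of _ "\<lambda>w. \<beta> w * \<gamma> w"]) (auto intro: continuous_on_mult)
    qed
    show "\<exists>f. P f \<and> f z \<noteq> f w" if "z \<in> Dhat H \<and> w \<in> Dhat H \<and> z \<noteq> w" for z w
    proof -
      obtain k where "z k \<noteq> w k" using \<open>_ \<and> _ \<and> z \<noteq> w\<close> by auto
      moreover have "P (\<lambda>z. Re (z k))" "P (\<lambda>z. Im (z k))"
        unfolding P_def by (intro exI[of _ k] exI[of _ Re] exI[of _ Im]; auto intro!: continuous_intros)+
      ultimately show ?thesis by (metis complex_eqI)
    qed
  qed (use assms in auto)
  then obtain g k \<beta> where "\<forall>z\<in>Dhat H. \<bar>\<alpha> z - g z\<bar> < e" "continuous_on Dsk \<beta>" "\<forall>z\<in>Dhat H. g z = \<beta> (z k)"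
    by (auto simp: P_def)
  then show ?thesis by (intro exI[of _ k] exI[of _ \<beta>]) auto
qed

text \<open>Every coordinate \<open>z k\<close> is regular, because
  \<open>(H ^^ k) (z k) = z 0\<close> and regularity passes to preimages. This settles test
  functions of one coordinate, whose integrals agree as the projections of \<open>\<mu>h\<close> are
  \<nu>; approximation gives the rest.\<close>

lemma regular_pt_Dhat:
  assumes H: "continuous_on Dsk H" "H ` Dsk \<subseteq> Dsk"
    and inv: "invlim_measure H \<nu> \<mu>h" and \<nu>: "emeasure \<nu> UNIV = 1"
    and z: "z \<in> Dhat H" and reg: "regular_pt Dsk H \<nu> (z 0)"
  shows "regular_pt (Dhat H) (Hhat H) \<mu>h z"
proof (rule regular_ptI)
  have m: "sets \<mu>h = sets borel" "emeasure \<mu>h (Dhat H) = 1" "\<And>n. distr \<mu>h borel (\<lambda>z. z n) = \<nu>"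
    using inv by (auto simp: invlim_measure_def)
  show "sets \<mu>h = sets borel" "emeasure \<mu>h (Dhat H) = 1" by fact+
  show "compact (Dhat H)" by (rule compact_Dhat[OF H(1)])
  show "Hhat H ` Dhat H \<subseteq> Dhat H" using Hhat_in_Dhat[OF H(2)] by blast
  show "z \<in> Dhat H" by fact
  have coord: "(\<lambda>z. z n) \<in> borel_measurable borel" for n :: nat
    by (rule borel_measurable_continuous_onI) (rule continuous_on_coordinate)
  have m1: "emeasure \<mu>h UNIV = 1"
  proof -
    have "emeasure (distr \<mu>h borel (\<lambda>z. z 0)) UNIV = emeasure \<mu>h UNIV"
      using coord[of 0] m(1) sets_eq_imp_space_eq[OF m(1)]
      by (subst emeasure_distr) (auto cong: measurable_cong_sets)
    then show ?thesis using m(3) \<nu> by simp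
  qed
  fix \<alpha> :: "(nat \<Rightarrow> complex) \<Rightarrow> real" and e :: real
  assume \<alpha>: "continuous_on (Dhat H) \<alpha>" "0 < e"
  obtain k \<beta> where \<beta>: "continuous_on Dsk \<beta>" "\<forall>w\<in>Dhat H. \<bar>\<alpha> w - \<beta> (w k)\<bar> < e"
    using Dhat_approx_by_coordinate[OF H \<alpha>] by blast
  have cont: "continuous_on (Dhat H) (\<lambda>w. \<beta> (w k))"
    by (rule continuous_on_compose2[OF \<beta>(1) continuous_on_coordinate]) (auto simp: Dhat_def)
  have "regular_pt Dsk H \<nu> (z k)"
  proof (rule regular_pt_funpow_preimage)
    show "regular_pt Dsk H \<nu> ((H ^^ k) (z k))" using reg Dhat_earlier_coordinate[OF z, of 0 k] by simp
  qed (use z H in \<open>auto simp: Dhat_def\<close>)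
  then have "(\<lambda>n. (\<Sum>i<n. \<beta> ((H ^^ i) (z k))) / real n) \<longlonglongrightarrow> integral\<^sup>L (restrict_space \<nu> Dsk) \<beta>"
    using \<beta>(1) by (simp add: regular_pt_def)
  moreover have "integral\<^sup>L (restrict_space \<nu> Dsk) \<beta> = integral\<^sup>L (restrict_space \<mu>h (Dhat H)) (\<lambda>w. \<beta> (w k))"
    using integral_restrict_distr[OF m(1) m1 m(2) coord, where N = Dsk and \<alpha> = \<beta>] m(3)[of k] \<beta>(1) cont
      compact_imp_closed[OF compact_Dsk] by (auto simp: Dhat_def)
  ultimately have "averages_converge (Dhat H) (Hhat H) \<mu>h z (\<lambda>w. \<beta> (w k))"
    by (simp add: averages_converge_def Hhat_funpow_coordinate[OF H(2) z])
  with cont \<beta>(2) show "\<exists>\<beta>. continuous_on (Dhat H) \<beta> \<and> (\<forall>w\<in>Dhat H. \<bar>\<alpha> w - \<beta> w\<bar> < e) \<and>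
      averages_converge (Dhat H) (Hhat H) \<mu>h z \<beta>" by blast
qed

section \<open>Regular points of tent maps\<close>

lemma (in expanding_tent) ergodic_acim:
  assumes "acim t \<mu>" shows "ergodic \<mu> (ftent t)"
proof -
  have \<mu>: "sets \<mu> = sets borel" "emeasure \<mu> UNIV = 1" "emeasure \<mu> {-1..1} = 1"
    "absolutely_continuous lborel \<mu>" "distr \<mu> borel (ftent t) = \<mu>"
    using assms by (auto simp: acim_def)
  have sp: "space \<mu> = UNIV" using sets_eq_imp_space_eq[OF \<mu>(1)] by simp
  have "ftent t \<in> borel_measurable borel"
    by (rule borel_measurable_continuous_onI) (rule continuous_on_ftent)
  then have T: "ftent t \<in> measurable \<mu> \<mu>"
    by (simp only: measurable_cong_sets[OF \<mu>(1) \<mu>(1)])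
  \<comment> \<open>Triviality is known for Lebesgue measure on I; it passes to \<mu>, which is
    absolutely continuous and carried by I.\<close>
  have null: "emeasure \<mu> N = 0" if "N \<in> sets borel" "emeasure lborel (N \<inter> {-1..1}) = 0" for N
  proof -
    have "N \<inter> {-1..1} \<in> null_sets lborel" using that by (intro null_setsI) auto
    then have "AE x in \<mu>. x \<notin> N \<inter> {-1..1}"
      using \<mu>(4) by (intro AE_not_in) (auto simp: absolutely_continuous_def)
    with AE_in_full_set[OF \<mu>(1-3)] have "AE x in \<mu>. x \<notin> N"
      by eventually_elim auto
    then show ?thesis
      using that(1) \<mu>(1) sp by (subst (asm) AE_iff_measurable[of N]) auto
  qed
  interpret finite_measure \<mu> using \<mu>(2) sp by (intro finite_measureI) simp
  show ?thesis
  proof unfold_locales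
    show "emeasure \<mu> (space \<mu>) = 1" using \<mu>(2) sp by simp
    show "ftent t \<in> measurable \<mu> \<mu>" by (rule T)
    show "distr \<mu> \<mu> (ftent t) = \<mu>" using \<mu>(5) distr_cong[OF refl \<mu>(1)] by metis
    fix A assume A: "A \<in> sets \<mu>" and inv: "\<And>x. x \<in> space \<mu> \<Longrightarrow> ftent t x \<in> A \<longleftrightarrow> x \<in> A"
    have "A \<in> sets borel" using A \<mu>(1) by simp
    then have "emeasure lborel (A \<inter> {-1..1}) = 0 \<or> emeasure lborel ({-1..1} - A) = 0"
      using inv sp by (intro invariant_set_trivial) auto
    moreover have "{-1..1} - A = (UNIV - A) \<inter> {-1..1}" by auto
    ultimately show "emeasure \<mu> A = 0 \<or> emeasure \<mu> (space \<mu> - A) = 0"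
      using null[of A] null[of "UNIV - A"] \<open>A \<in> sets borel\<close> sp by auto
  qed
qed

text \<open>Averages are linear in the test function and polynomials are uniformly dense on I, so
  the countably many monomials suffice.\<close>

lemma (in expanding_tent) regular_pt_ftentI:
  assumes \<mu>: "sets \<mu> = sets borel" "emeasure \<mu> {-1..1} = 1" and x: "x \<in> {-1..1}"
    and powers: "\<And>k. averages_converge {-1..1} (ftent t) \<mu> x (\<lambda>x. x ^ k)"
  shows "regular_pt {-1..1} (ftent t) \<mu> x"
proof (rule regular_ptI)
  fix \<alpha> :: "real \<Rightarrow> real" and e :: real assume \<alpha>: "continuous_on {-1..1} \<alpha>" "0 < e"
  obtain \<beta> where "real_polynomial_function \<beta>" and close: "\<And>x. x \<in> {-1..1} \<Longrightarrow> \<bar>\<alpha> x - \<beta> x\<bar> < e"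
    using Stone_Weierstrass_real_polynomial_function[OF compact_Icc \<alpha>] by blast
  then obtain a n where \<beta>: "\<beta> = (\<lambda>x. \<Sum>k\<le>n. a k * x ^ k)"
    by (auto simp: real_polynomial_function_iff_sum)
  let ?N = "restrict_space \<mu> {-1..1}"
  have int: "integrable ?N (\<lambda>x. x ^ k)" for k
    by (intro integrable_restrict_space_compact[OF \<mu>] continuous_intros) auto
  have "(\<lambda>m. \<Sum>k\<le>n. a k * ((\<Sum>i<m. ((ftent t ^^ i) x) ^ k) / real m)) \<longlonglongrightarrow> (\<Sum>k\<le>n. a k * (\<integral>x. x ^ k \<partial>?N))"
    using powers by (intro tendsto_sum tendsto_mult tendsto_const) (simp add: averages_converge_def)
  moreover have "(\<Sum>k\<le>n. a k * ((\<Sum>i<m. ((ftent t ^^ i) x) ^ k) / real m)) = (\<Sum>i<m. \<beta> ((ftent t ^^ i) x)) / real m" for m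
    unfolding \<beta> by (subst sum.swap) (simp add: sum_divide_distrib sum_distrib_left)
  moreover have "(\<Sum>k\<le>n. a k * (\<integral>x. x ^ k \<partial>?N)) = integral\<^sup>L ?N \<beta>"
    unfolding \<beta> by (subst Bochner_Integration.integral_sum) (use int in auto)
  ultimately have "averages_converge {-1..1} (ftent t) \<mu> x \<beta>"
    by (simp add: averages_converge_def)
  moreover have "continuous_on {-1..1} \<beta>" unfolding \<beta> by (intro continuous_intros)
  ultimately show "\<exists>\<beta>. continuous_on {-1..1} \<beta> \<and> (\<forall>z\<in>{-1..1}. \<bar>\<alpha> z - \<beta> z\<bar> < e) \<and>
      averages_converge {-1..1} (ftent t) \<mu> x \<beta>" using close by blast
qed (use \<mu> x ftent_in_I in auto)

text \<open>Birkhoff's theorem for all monomials leaves out one \<mu>-null set. Its complement in I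
  has \<mu>-measure 1, so by absolute continuity it cannot be Lebesgue null.\<close>

lemma (in expanding_tent) acim_regular_set:
  assumes "acim t \<mu>"
  shows "\<exists>G. G \<in> sets borel \<and> G \<subseteq> {-1..1} \<and> emeasure lborel G \<noteq> 0 \<and>
    (\<forall>x\<in>G. regular_pt {-1..1} (ftent t) \<mu> x)"
proof -
  interpret ergodic \<mu> "ftent t" by (rule ergodic_acim[OF assms])
  have \<mu>: "sets \<mu> = sets borel" "emeasure \<mu> UNIV = 1" "emeasure \<mu> {-1..1} = 1"
    "absolutely_continuous lborel \<mu>"
    using assms by (auto simp: acim_def)
  have sp: "space \<mu> = UNIV" using sets_eq_imp_space_eq[OF \<mu>(1)] by simp
  \<comment> \<open>The indicator makes the monomials bounded on the whole line and is constantly 1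
    along orbits in I.\<close>
  let ?g = "\<lambda>k x. indicator {-1..1} x * x ^ k :: real"
  have ae: "AE x in \<mu>. (\<lambda>n. (\<Sum>i<n. ?g k ((ftent t ^^ i) x)) / real n) \<longlonglongrightarrow> (\<integral>x. ?g k x \<partial>\<mu>)" for k
  proof (rule birkhoff, rule integrable_const_bound[where B = 1])
    show "AE x in \<mu>. norm (?g k x) \<le> 1"
      by (intro AE_I2) (auto simp: indicator_def power_abs intro!: power_le_one)
    show "?g k \<in> borel_measurable \<mu>"
      by (simp only: measurable_cong_sets[OF \<mu>(1) refl]) measurable
  qed
  have "AE x in \<mu>. \<forall>k. (\<lambda>n. (\<Sum>i<n. ?g k ((ftent t ^^ i) x)) / real n) \<longlonglongrightarrow> (\<integral>x. ?g k x \<partial>\<mu>)"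
    unfolding AE_all_countable using ae by blast
  then obtain N where N: "{x \<in> space \<mu>. \<not> (\<forall>k. (\<lambda>n. (\<Sum>i<n. ?g k ((ftent t ^^ i) x)) / real n)
      \<longlonglongrightarrow> (\<integral>x. ?g k x \<partial>\<mu>))} \<subseteq> N" "emeasure \<mu> N = 0" "N \<in> sets \<mu>"
    by (rule AE_E)
  let ?G = "{-1..1} - N"
  have "?G \<in> sets borel" using N(3) \<mu>(1) by auto
  moreover have "emeasure lborel ?G \<noteq> 0"
  proof
    assume "emeasure lborel ?G = 0"
    then have "?G \<in> null_sets lborel"
      using \<open>?G \<in> sets borel\<close> by (intro null_setsI) simp_all
    then have "?G \<in> null_sets \<mu>"
      using \<mu>(4) unfolding absolutely_continuous_def by blast
    then have "emeasure \<mu> (?G \<union> N) = 0"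
      using N by (metis null_sets.Un null_setsD1 null_setsI)
    moreover have "emeasure \<mu> {-1..1} \<le> emeasure \<mu> (?G \<union> N)"
      using N(3) \<mu>(1) by (intro emeasure_mono) auto
    ultimately show False using \<mu>(3) by simp
  qed
  moreover have "regular_pt {-1..1} (ftent t) \<mu> x" if x: "x \<in> ?G" for x
  proof (rule regular_pt_ftentI[OF \<mu>(1,3)])
    show "x \<in> {-1..1}" using x by simp
    fix k
    have "ftent t ` {-1..1} \<subseteq> {-1..1}" using ftent_in_I by blast
    then have "(ftent t ^^ i) x \<in> {-1..1}" for i
      using x by (intro funpow_in) simp_all
    then have "(\<Sum>i<n. ?g k ((ftent t ^^ i) x)) = (\<Sum>i<n. ((ftent t ^^ i) x) ^ k)" for n
      by (intro sum.cong) (simp_all add: indicator_def)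
    moreover have "(\<integral>x. ?g k x \<partial>\<mu>) = (\<integral>x. x ^ k \<partial>restrict_space \<mu> {-1..1})"
      using \<mu>(1) sp by (subst integral_restrict_space) auto
    moreover have "(\<lambda>n. (\<Sum>i<n. ?g k ((ftent t ^^ i) x)) / real n) \<longlonglongrightarrow> (\<integral>x. ?g k x \<partial>\<mu>)"
      using N(1) x sp by auto
    ultimately show "averages_converge {-1..1} (ftent t) \<mu> x (\<lambda>x. x ^ k)"
      by (simp only: averages_converge_def)
  qed
  ultimately show ?thesis by blast
qed

section \<open>Physical measures\<close>

lemma unwrapping_Hmap:
  assumes "unwrapping fb" "t \<in> Jint"
  shows "continuous_on Dsk (Hmap fb t)" "Hmap fb t ` Dsk \<subseteq> Dsk"
    "x \<in> {-1..1} \<Longrightarrow> Hmap fb t (complex_of_real x) = complex_of_real (ftent t x)"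
proof -
  have fb: "continuous_on (Jint \<times> Dsk) (\<lambda>(t, z). fb t z)" "fb t ` Dsk \<subseteq> Dsk"
    "\<And>x. x \<in> {-1..1} \<Longrightarrow> Ups (fb t (complex_of_real x)) = complex_of_real (ftent t x)"
    using assms by (auto simp: unwrapping_def op_near_homeo_def)
  have "continuous_on Dsk (\<lambda>z. (\<lambda>(t, z). fb t z) (t, z))"
    by (rule continuous_on_compose2[OF fb(1)]) (use assms(2) in \<open>auto intro!: continuous_intros\<close>)
  then have "continuous_on Dsk (fb t)" by simp
  then show "continuous_on Dsk (Hmap fb t)"
    unfolding Hmap_def by (intro continuous_on_compose continuous_on_subset[OF continuous_on_Ups] fb(2))
  show "Hmap fb t ` Dsk \<subseteq> Dsk"
    using fb(2) Ups_in_Dsk by (auto simp: Hmap_def)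
  show "x \<in> {-1..1} \<Longrightarrow> Hmap fb t (complex_of_real x) = complex_of_real (ftent t x)"
    using fb(3) by (simp add: Hmap_def)
qed

text \<open>On I the map of the disk is the tent map, and test functions on the disk restrict to
  test functions on I.\<close>

lemma regular_pt_of_real:
  assumes "unwrapping fb" "t \<in> Jint" and \<mu>: "acim t \<mu>"
    and reg: "regular_pt {-1..1} (ftent t) \<mu> x"
  shows "regular_pt Dsk (Hmap fb t) (nuD \<mu>) (complex_of_real x)"
  unfolding regular_pt_def
proof (intro conjI allI impI)
  interpret expanding_tent t using assms(2) by unfold_locales (auto simp: Jint_def)
  have x: "x \<in> {-1..1}" using reg by (simp add: regular_pt_def)
  then show "complex_of_real x \<in> Dsk" by (rule of_real_in_Dsk)
  have "ftent t ` {-1..1} \<subseteq> {-1..1}" using ftent_in_I by blast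
  then have in_I: "(ftent t ^^ i) x \<in> {-1..1}" for i
    using x by (rule funpow_in)
  have orbit: "(Hmap fb t ^^ i) (complex_of_real x) = complex_of_real ((ftent t ^^ i) x)" for i
  proof (induction i)
    case (Suc i)
    then show ?case using unwrapping_Hmap(3)[OF assms(1,2) in_I[of i]] by simp
  qed simp
  fix \<alpha> :: "complex \<Rightarrow> real" assume \<alpha>: "continuous_on Dsk \<alpha>"
  have cont: "continuous_on {-1..1} (\<lambda>x. \<alpha> (complex_of_real x))"
    by (rule continuous_on_compose2[OF \<alpha>]) (auto intro!: continuous_intros of_real_in_Dsk)
  have "integral\<^sup>L (restrict_space (nuD \<mu>) Dsk) \<alpha> = integral\<^sup>L (restrict_space \<mu> {-1..1}) (\<lambda>x. \<alpha> (complex_of_real x))"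
    unfolding nuD_def
  proof (rule integral_restrict_distr[OF _ _ _ _ _ _ \<alpha> cont])
    show "complex_of_real \<in> borel_measurable borel"
      by (intro borel_measurable_continuous_onI continuous_intros)
    show "Dsk \<in> sets borel" using compact_imp_closed[OF compact_Dsk] by simp
  qed (use \<mu> in \<open>auto simp: acim_def intro!: of_real_in_Dsk\<close>)
  moreover have "(\<lambda>n. (\<Sum>i<n. \<alpha> (complex_of_real ((ftent t ^^ i) x))) / real n)
      \<longlonglongrightarrow> integral\<^sup>L (restrict_space \<mu> {-1..1}) (\<lambda>x. \<alpha> (complex_of_real x))"
    using reg cont unfolding regular_pt_def by blast
  ultimately show "(\<lambda>n. (\<Sum>i<n. \<alpha> ((Hmap fb t ^^ i) (complex_of_real x))) / real n)
      \<longlonglongrightarrow> integral\<^sup>L (restrict_space (nuD \<mu>) Dsk) \<alpha>"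
    by (simp add: orbit)
qed

lemma Hmap_cc:
  assumes "\<forall>t'\<in>Jint. \<forall>z\<in>Sband 0 (3/4). fb t' z = z" "t \<in> Jint" "0 \<le> s" "s \<le> 3/4"
  shows "Hmap fb t (cc y s) = cc y (min 1 (2 * s))"
proof -
  have "cc y s \<in> Sband 0 (3/4)" using assms(3,4) by (force simp: Sband_def)
  then show ?thesis using assms by (simp add: Hmap_def Ups_cc)
qed

text \<open>A point determines \<open>s\<close> and \<open>cos y\<close>, so in coordinates the set
  is the rectangle \<open>?Y \<times> {a..b}\<close>. Were \<open>?Y\<close> null, its image under
  the differentiable cosine would be null too, but that image contains \<open>G\<close>.\<close>

lemma coord_pos_radial:
  assumes G: "G \<in> sets borel" "G \<subseteq> {-1..1}" "emeasure lborel G \<noteq> 0"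
    and ab: "0 \<le> a" "a < b" "b < 1"
  shows "coord_pos {cc y s | y s. a \<le> s \<and> s \<le> b \<and> cos y \<in> G}"
proof -
  let ?Y = "{0..2 * pi} \<inter> cos -` G"
  have P: "{p \<in> {0..2 * pi} \<times> {0..1}. cc (fst p) (snd p) \<in> {cc y s | y s. a \<le> s \<and> s \<le> b \<and> cos y \<in> G}}
      = ?Y \<times> {a..b}"
  proof (intro set_eqI iffI)
    fix p assume "p \<in> {p \<in> {0..2 * pi} \<times> {0..1}. cc (fst p) (snd p) \<in> {cc y s | y s. a \<le> s \<and> s \<le> b \<and> cos y \<in> G}}"
    then obtain y s where p: "p \<in> {0..2 * pi} \<times> {0..1}" "cc (fst p) (snd p) = cc y s" "a \<le> s" "s \<le> b" "cos y \<in> G"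
      by blast
    then have "snd p = s" "cos (fst p) = cos y"
      using cc_inject[of "fst p" "snd p" y s] ab by (auto simp: mem_Times_iff)
    with p show "p \<in> ?Y \<times> {a..b}" by (auto simp: mem_Times_iff)
  next
    fix p assume "p \<in> ?Y \<times> {a..b}"
    then show "p \<in> {p \<in> {0..2 * pi} \<times> {0..1}. cc (fst p) (snd p) \<in> {cc y s | y s. a \<le> s \<and> s \<le> b \<and> cos y \<in> G}}"
      using ab by (auto simp: mem_Times_iff)
  qed
  have "cos \<in> borel_measurable (borel :: real measure)"
    by (intro borel_measurable_continuous_onI continuous_intros)
  from measurable_sets[OF this G(1)] have Y: "?Y \<in> sets borel" by auto
  then have "?Y \<times> {a..b} \<in> sets (borel \<Otimes>\<^sub>M borel)" by (intro pair_measureI) auto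
  then have PY: "?Y \<times> {a..b} \<in> sets borel" by (simp only: borel_prod)
  have "emeasure lborel ?Y \<noteq> 0"
  proof
    assume "emeasure lborel ?Y = 0"
    then have "negligible ?Y"
      using Y by (subst negligible_iff_emeasure0) auto
    then have "negligible (cos ` ?Y)"
      by (rule negligible_differentiable_image_negligible[OF order_refl])
        (auto simp: differentiable_on_def intro!: field_differentiable_imp_differentiable field_differentiable_within_cos)
    moreover have "G \<subseteq> cos ` ?Y"
    proof
      fix x assume "x \<in> G"
      then have "x \<in> {-1..1}" using G(2) by blast
      then show "x \<in> cos ` ?Y"
        using \<open>x \<in> G\<close> arccos_lbound[of x] arccos_ubound[of x] pi_gt_zero
        by (intro image_eqI[of _ _ "arccos x"]) (auto simp del: pi_gt_zero)
    qed
    ultimately have "negligible G" by (rule negligible_subset)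
    then show False using G(1,3) by (simp add: negligible_iff_emeasure0)
  qed
  moreover have "emeasure lborel (?Y \<times> {a..b}) = emeasure lborel ?Y * emeasure lborel {a..b}"
    unfolding lborel_prod[symmetric] using Y by (intro lborel.emeasure_pair_measure_Times) auto
  ultimately have "emeasure lborel (?Y \<times> {a..b}) \<noteq> 0" using ab by simp
  then show ?thesis
    unfolding coord_pos_def P Let_def using PY by (simp add: zero_less_iff_neq_zero)
qed

theorem mainTheorem5:
  fixes fb :: "real \<Rightarrow> complex \<Rightarrow> complex"
    and t :: real and \<mu> :: "real measure" and \<mu>h :: "(nat \<Rightarrow> complex) measure"
  assumes "unwrapping fb"
    and "\<forall>t'\<in>Jint. \<forall>z\<in>Sband 0 (3/4). fb t' z = z"
    and "t \<in> Jint"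
    and "acim t \<mu>"
    and "invlim_measure (Hmap fb t) (nuD \<mu>) \<mu>h"
  shows "physical (Hmap fb t) (nuD \<mu>) \<and> invlim_physical (Hmap fb t) \<mu>h"
proof -
  let ?H = "Hmap fb t"
  note H = unwrapping_Hmap[OF assms(1,3)]
  interpret expanding_tent t using assms(3) by unfold_locales (auto simp: Jint_def)
  obtain G where G: "G \<in> sets borel" "G \<subseteq> {-1..1}" "emeasure lborel G \<noteq> 0"
    "\<And>x. x \<in> G \<Longrightarrow> regular_pt {-1..1} (ftent t) \<mu> x"
    using acim_regular_set[OF assms(4)] by blast
  define B where "B = {cc y s | y s. 1/2 \<le> s \<and> s \<le> 3/4 \<and> cos y \<in> G}"
  have pos: "coord_pos B"
    unfolding B_def by (intro coord_pos_radial G) auto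
  have reg: "regular_pt Dsk ?H (nuD \<mu>) z" if zB: "z \<in> B" for z
  proof -
    obtain y s where z: "z = cc y s" "1/2 \<le> s" "s \<le> 3/4" "cos y \<in> G"
      using zB unfolding B_def by blast
    have "?H z = complex_of_real (cos y)"
      using Hmap_cc[OF assms(2,3), of s y] z by (simp add: cc_def[of y 1] complex_of_real_def)
    then have "regular_pt Dsk ?H (nuD \<mu>) (?H z)"
      using regular_pt_of_real[OF assms(1,3,4) G(4)[OF z(4)]] by simp
    then show ?thesis
      by (rule regular_pt_preimage) (use z in \<open>auto intro: cc_in_Dsk\<close>)
  qed
  have BD: "B \<subseteq> Dsk" using reg by (auto simp: regular_pt_def)
  have "physical ?H (nuD \<mu>)"
    unfolding physical_def basin_def using pos reg BD by blast
  moreover have "invlim_physical ?H \<mu>h"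
    unfolding invlim_physical_def
  proof (intro exI conjI)
    let ?B = "{z \<in> Dhat ?H. z 0 \<in> B}"
    have "sets \<mu> = sets borel" "emeasure \<mu> UNIV = 1" using assms(4) by (auto simp: acim_def)
    then have "emeasure (nuD \<mu>) UNIV = 1"
      using sets_eq_imp_space_eq[of \<mu> borel] unfolding nuD_def
      by (subst emeasure_distr) (auto intro!: borel_measurable_continuous_onI continuous_intros cong: measurable_cong_sets)
    then show "basin (Dhat ?H) (Hhat ?H) \<mu>h ?B"
      unfolding basin_def using regular_pt_Dhat[OF H(1,2) assms(5)] reg by blast
    \<comment> \<open>Having every point of \<open>B\<close> as the start of a thread makes the
      projection of the basin all of \<open>B\<close>, so measurability and positive measure carry
      over.\<close>
    have "B \<subseteq> (\<lambda>z. z 0) ` ?B"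
    proof
      fix z assume "z \<in> B"
      then obtain y s where z: "z = cc y s" "1/2 \<le> s" "s \<le> 3/4"
        unfolding B_def by blast
      let ?z = "\<lambda>n. cc y (s / 2 ^ n)"
      have s: "0 \<le> s / 2 ^ n" "s / 2 ^ n \<le> s" for n
        using z(2) by (auto simp: divide_le_eq_1 intro!: divide_left_mono[of 1 "2 ^ n" s, simplified])
      have "?H (?z (Suc n)) = ?z n" for n
      proof -
        have "?H (?z (Suc n)) = cc y (min 1 (2 * (s / 2 ^ Suc n)))"
          using s[of "Suc n"] z(3) by (intro Hmap_cc assms(2,3)) auto
        \<comment> \<open>The cap at 1 is inactive here, so \<open>H\<close> exactly undoes the
          halving of \<open>s\<close>.\<close>
        moreover have "s / 2 ^ n \<le> 1" using s[of n] z(3) by linarith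
        moreover have "2 * (s / 2 ^ Suc n) = s / 2 ^ n" by simp
        ultimately show ?thesis by (simp only: min_absorb2)
      qed
      moreover have "?z n \<in> Dsk" for n using s[of n] z(3) by (intro cc_in_Dsk) linarith+
      ultimately have "?z \<in> ?B" using \<open>z \<in> B\<close> z(1) by (simp add: Dhat_def)
      then show "z \<in> (\<lambda>z. z 0) ` ?B" using z(1) by (intro image_eqI[of _ _ ?z]) simp_all
    qed
    then have "(\<lambda>z. z 0) ` ?B = B" by auto
    then show "coord_pos ((\<lambda>z. z 0) ` ?B)" using pos by simp
  qed
  ultimately show ?thesis ..
qed

end
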